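(* Let $d>3$ be an integer. There exists a symmetric convex body $B\subset\mathbb{R}^d$ with a smooth boundary and everywhere non-vanishing Gaussian curvature such that for every real $s<\frac{d+1}{2}$ there exists a Borel measure $\mu_s$ on $\mathbb{R}^d$ such that $I_s(\mu_s)=O(1)$ (that is, $I_s(\mu_s)<\infty$) and $$\limsup_{\epsilon\to 0^+}\ \epsilon^{-3}\,(\mu_s\times\mu_s\times\mu_s)\bigl\{(\mathbf{x}_1,\mathbf{x}_2,\mathbf{x}_3)\in(\mathbb{R}^d)^3:\ 1-\epsilon\le\|\mathbf{x}_i-\mathbf{x}_j\|_B\le 1+\epsilon\ \text{ for all } 1\le i<j\le 3\bigr\}\ =\ \infty .$$
   Context: For a convex body $B\subset\mathbb{R}^d$ symmetric about the origin, $\|\cdot\|_B$ denotes the norm on $\mathbb{R}^d$ whose closed unit ball is $B$. For a Borel measure $\mu$ on $\mathbb{R}^d$, the energy integral is $I_s(\mu)=\int\int|\mathbf{x}-\mathbf{y}|^{-s}\,d\mu(\mathbf{x})\,d\mu(\mathbf{y})$, where $|\cdot|$ is the Euclidean norm. *)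

theory Defs
  imports "HOL-Analysis.Analysis"
begin

section \<open>Symmetric convex bodies and their norms\<close>

definition symmetric_convex_body :: "'a::euclidean_space set \<Rightarrow> bool" where
  "symmetric_convex_body B \<longleftrightarrow>
     convex B \<and> compact B \<and> interior B \<noteq> {} \<and> (\<forall>x\<in>B. - x \<in> B)"

text \<open>The Minkowski functional of \<open>B\<close>; the lemmas below show that for a symmetric convex body
  it is the norm whose closed unit ball is \<open>B\<close>.\<close>

definition body_norm :: "'a::euclidean_space set \<Rightarrow> 'a \<Rightarrow> real" where
  "body_norm B x = Inf {t. 0 < t \<and> x \<in> (*\<^sub>R) t ` B}"

lemma symmetric_convex_body_zero_interior:
  assumes "symmetric_convex_body B"
  obtains r where "r > 0" "ball 0 r \<subseteq> B"
proof -
  have cB: "convex B" and sB: "\<And>x. x \<in> B \<Longrightarrow> - x \<in> B" and "interior B \<noteq> {}"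
    using assms by (auto simp: symmetric_convex_body_def)
  then obtain a r where r: "r > 0" "ball a r \<subseteq> B"
    by (metis ex_in_conv mem_interior)
  have "z \<in> B" if z: "z \<in> ball 0 r" for z
  proof -
    have "a + z \<in> B" "a - z \<in> B"
      using z r(2) by (auto simp: dist_norm subset_iff)
    then have "(1/2) *\<^sub>R (a + z) + (1/2) *\<^sub>R (- (a - z)) \<in> B"
      using cB \<open>a + z \<in> B\<close> sB[OF \<open>a - z \<in> B\<close>] by (intro convexD) auto
    moreover have "(1/2) *\<^sub>R (a + z) + (1/2) *\<^sub>R (- (a - z)) = z"
      by (simp add: algebra_simps flip: scaleR_add_left)
    ultimately show "z \<in> B" by simp
  qed
  then show thesis using that r(1) by blast
qed

lemma body_norm_le_iff:
  assumes B: "symmetric_convex_body B" and t: "t > 0"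
  shows "body_norm B x \<le> t \<longleftrightarrow> x \<in> (*\<^sub>R) t ` B"
proof -
  let ?S = "{t. 0 < t \<and> x \<in> (*\<^sub>R) t ` B}"
  obtain r where r: "r > 0" "ball 0 r \<subseteq> B"
    using symmetric_convex_body_zero_interior[OF B] .
  have cB: "convex B" and clB: "closed B"
    using B by (auto simp: symmetric_convex_body_def compact_imp_closed)
  have 0: "0 \<in> B" using r by auto
  have mem: "s \<in> ?S \<longleftrightarrow> 0 < s \<and> x /\<^sub>R s \<in> B" for s
  proof -
    have "x \<in> (*\<^sub>R) s ` B \<longleftrightarrow> x /\<^sub>R s \<in> B" if "0 < s"
    proof
      assume "x /\<^sub>R s \<in> B"
      moreover have "x = s *\<^sub>R (x /\<^sub>R s)" using that by simp
      ultimately show "x \<in> (*\<^sub>R) s ` B" by blast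
    qed (use that in auto)
    then show ?thesis by blast
  qed
  have mono: "s \<in> ?S" if "u \<in> ?S" "u \<le> s" for u s
  proof -
    have u: "0 < u" "x /\<^sub>R u \<in> B" using that(1)[THEN mem[THEN iffD1]] by blast+
    have "(u/s) *\<^sub>R (x /\<^sub>R u) + (1 - u/s) *\<^sub>R 0 \<in> B"
      using u that(2) 0 cB by (intro convexD) auto
    moreover have "(u/s) *\<^sub>R (x /\<^sub>R u) = x /\<^sub>R s"
    proof -
      have "(u/s) * inverse u = inverse s" using u(1) by (simp add: divide_inverse)
      then show ?thesis by (simp only: scaleR_scaleR)
    qed
    ultimately have "0 < s \<and> x /\<^sub>R s \<in> B"
      using u(1) that(2) by (metis add.right_neutral order.strict_trans2 scaleR_zero_right)
    then show ?thesis by (rule mem[THEN iffD2])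
  qed
  have ne: "?S \<noteq> {}"
  proof -
    define u where "u = (norm x + 1) / r"
    have u: "u > 0" "u * r = norm x + 1"
      using r(1) by (simp_all add: u_def add_nonneg_pos)
    then have "norm x < r * u" by (simp add: mult.commute)
    then have "x /\<^sub>R u \<in> ball 0 r"
      using u(1) by (simp add: divide_inverse[symmetric] pos_divide_less_eq mult.commute[of "inverse u"])
    then have "0 < u \<and> x /\<^sub>R u \<in> B" using r u(1) by blast
    then have "u \<in> ?S" by (rule mem[THEN iffD2])
    then show ?thesis by blast
  qed
  have bdd: "bdd_below ?S" by (auto intro!: bdd_belowI[of _ 0])
  show ?thesis
  proof
    assume "x \<in> (*\<^sub>R) t ` B"
    then show "body_norm B x \<le> t"
      unfolding body_norm_def using t bdd by (intro cInf_lower) auto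
  next
    assume le: "body_norm B x \<le> t"
    have ev: "x /\<^sub>R (t + 1 / real (Suc n)) \<in> B" for n
    proof -
      have "Inf ?S < t + 1 / real (Suc n)"
        using le unfolding body_norm_def 
        by (rule order.strict_trans1) simp
      then obtain u where "u \<in> ?S" "u < t + 1 / real (Suc n)"
        using ne bdd by (meson cInf_lessD)
      then have "t + 1 / real (Suc n) \<in> ?S"
        by (rule mono[OF _ less_imp_le])
      then show ?thesis by (rule mem[THEN iffD1, THEN conjunct2])
    qed
    have "(\<lambda>n. t + 1 / real (Suc n)) \<longlonglongrightarrow> t + 0"
      by (intro tendsto_intros LIMSEQ_Suc[OF lim_1_over_n])
    then have "(\<lambda>n. x /\<^sub>R (t + 1 / real (Suc n))) \<longlonglongrightarrow> x /\<^sub>R t"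
      using t by (intro tendsto_intros) auto
    then have "x /\<^sub>R t \<in> B"
      by (rule closed_sequentially[OF clB ev])
    then have "0 < t \<and> x /\<^sub>R t \<in> B" using t by blast
    then have "t \<in> ?S" by (rule mem[THEN iffD2])
    then show "x \<in> (*\<^sub>R) t ` B" by blast
  qed
qed

lemma body_norm_unit_ball:
  assumes "symmetric_convex_body B"
  shows "{x. body_norm B x \<le> 1} = B"
  using body_norm_le_iff[OF assms, of 1] by auto

lemma body_norm_nonneg:
  assumes B: "symmetric_convex_body B"
  shows "0 \<le> body_norm B x"
proof (rule ccontr)
  assume "\<not> 0 \<le> body_norm B x"
  then have neg: "body_norm B x < 0" by simp
  let ?S = "{t. 0 < t \<and> x \<in> (*\<^sub>R) t ` B}"
  have "x \<in> (*\<^sub>R) 1 ` B"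
    using body_norm_le_iff[OF B zero_less_one, of x] neg by linarith
  then have "1 \<in> ?S" by simp
  then have "?S \<noteq> {}" by blast
  then have "0 \<le> Inf ?S" by (intro cInf_greatest) auto
  then show False using neg by (simp add: body_norm_def)
qed

lemma body_norm_eq_zero_iff:
  assumes B: "symmetric_convex_body B"
  shows "body_norm B x = 0 \<longleftrightarrow> x = 0"
proof
  assume x: "body_norm B x = 0"
  obtain C where C: "\<And>y. y \<in> B \<Longrightarrow> norm y \<le> C"
    using B unfolding symmetric_convex_body_def by (meson bounded_iff compact_imp_bounded)
  have bd: "norm x \<le> t * C" if "t > 0" for t
  proof -
    have "x \<in> (*\<^sub>R) t ` B" using body_norm_le_iff[OF B that, of x] x that by linarith
    then show ?thesis using C that by (auto intro!: mult_left_mono)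
  qed
  show "x = 0"
  proof (rule ccontr)
    assume "x \<noteq> 0"
    then have n: "norm x > 0" by simp
    then have "C > 0" using bd[of 1] by linarith
    then show False using bd[of "norm x / (2 * C)"] n by simp
  qed
next
  assume "x = 0"
  obtain r where "r > 0" "ball 0 r \<subseteq> B"
    using symmetric_convex_body_zero_interior[OF B] .
  then have "0 \<in> B" by auto
  then have "x \<in> (*\<^sub>R) t ` B" for t using \<open>x = 0\<close> by (auto simp: image_iff)
  then have "body_norm B x \<le> t" if "t > 0" for t
    using body_norm_le_iff[OF B that] by blast
  then have "body_norm B x \<le> 0" by (rule dense_ge)
  then show "body_norm B x = 0" using body_norm_nonneg[OF B, of x] by simp
qed

lemma body_norm_triangle:
  assumes B: "symmetric_convex_body B"
  shows "body_norm B (x + y) \<le> body_norm B x + body_norm B y"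
proof (rule field_le_epsilon)
  fix e :: real assume e: "e > 0"
  define a b where "a = body_norm B x + e/2" and "b = body_norm B y + e/2"
  have pos: "a > 0" "b > 0"
    using e body_norm_nonneg[OF B] by (simp_all add: a_def b_def add_nonneg_pos)
  have "x \<in> (*\<^sub>R) a ` B" "y \<in> (*\<^sub>R) b ` B"
    using body_norm_le_iff[OF B pos(1), of x] body_norm_le_iff[OF B pos(2), of y] e
    by (auto simp: a_def b_def)
  then obtain u v where uv: "u \<in> B" "x = a *\<^sub>R u" "v \<in> B" "y = b *\<^sub>R v" by auto
  have "(a/(a+b)) *\<^sub>R u + (b/(a+b)) *\<^sub>R v \<in> B"
    using uv pos B by (intro convexD) (auto simp: symmetric_convex_body_def simp flip: add_divide_distrib)
  moreover have "x + y = (a+b) *\<^sub>R ((a/(a+b)) *\<^sub>R u + (b/(a+b)) *\<^sub>R v)"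
    using uv pos by (simp add: scaleR_add_right)
  ultimately have "x + y \<in> (*\<^sub>R) (a+b) ` B" by blast
  then have "body_norm B (x + y) \<le> a + b"
    using body_norm_le_iff[OF B, of "a+b"] pos by auto
  then show "body_norm B (x + y) \<le> body_norm B x + body_norm B y + e"
    by (simp add: a_def b_def)
qed

lemma body_norm_scaleR:
  assumes B: "symmetric_convex_body B"
  shows "body_norm B (c *\<^sub>R x) = \<bar>c\<bar> * body_norm B x"
proof -
  have le: "body_norm B (c *\<^sub>R x) \<le> \<bar>c\<bar> * body_norm B x" if c: "c \<noteq> 0" for c x
  proof (rule field_le_epsilon)
    fix e :: real assume e: "e > 0"
    define a where "a = body_norm B x + e / \<bar>c\<bar>"
    have a: "a > 0" using e c body_norm_nonneg[OF B, of x] by (simp add: a_def add_nonneg_pos)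
    have "x \<in> (*\<^sub>R) a ` B"
      using body_norm_le_iff[OF B a, of x] e c by (auto simp: a_def)
    then obtain u where u: "u \<in> B" "x = a *\<^sub>R u" by auto
    have "sgn c *\<^sub>R u \<in> B"
      using u c B by (cases "c > 0") (auto simp: symmetric_convex_body_def sgn_if)
    moreover have "c *\<^sub>R x = (\<bar>c\<bar> * a) *\<^sub>R (sgn c *\<^sub>R u)"
      using u by (simp add: sgn_if)
    ultimately have "c *\<^sub>R x \<in> (*\<^sub>R) (\<bar>c\<bar> * a) ` B" by blast
    then have "body_norm B (c *\<^sub>R x) \<le> \<bar>c\<bar> * a"
      using body_norm_le_iff[OF B, of "\<bar>c\<bar> * a"] a c by auto
    also have "\<dots> = \<bar>c\<bar> * body_norm B x + e" using c by (simp add: a_def field_simps)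
    finally show "body_norm B (c *\<^sub>R x) \<le> \<bar>c\<bar> * body_norm B x + e" .
  qed
  show ?thesis
  proof (cases "c = 0")
    case True
    then show ?thesis using body_norm_eq_zero_iff[OF B, of 0] by simp
  next
    case False
    have "body_norm B (inverse c *\<^sub>R (c *\<^sub>R x)) \<le> \<bar>inverse c\<bar> * body_norm B (c *\<^sub>R x)"
      using le[of "inverse c" "c *\<^sub>R x"] False by simp
    then have "\<bar>c\<bar> * body_norm B x \<le> body_norm B (c *\<^sub>R x)"
      using False by (simp add: field_simps)
    then show ?thesis using le[OF False, of x] by simp
  qed
qed

section \<open>Smooth hypersurfaces and Gaussian curvature\<close>

text \<open>\<open>C\<^sup>k\<close> functions on an open set: all iterated partial derivatives up to order \<open>k\<close> exist
  everywhere (as Frechet derivatives) and are continuous.\<close>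

primrec Ck_on :: "nat \<Rightarrow> 'a::euclidean_space set \<Rightarrow> ('a \<Rightarrow> real) \<Rightarrow> bool" where
  "Ck_on 0 U f \<longleftrightarrow> continuous_on U f"
| "Ck_on (Suc k) U f \<longleftrightarrow>
     (\<forall>x\<in>U. f differentiable at x) \<and>
     (\<forall>b\<in>Basis. Ck_on k U (\<lambda>x. frechet_derivative f (at x) b))"

definition smooth_on :: "'a::euclidean_space set \<Rightarrow> ('a \<Rightarrow> real) \<Rightarrow> bool" where
  "smooth_on U f \<longleftrightarrow> (\<forall>k. Ck_on k U f)"

definition gradient :: "(real ^ 'd \<Rightarrow> real) \<Rightarrow> real ^ 'd \<Rightarrow> real ^ 'd" where
  "gradient f x = (\<chi> i. frechet_derivative f (at x) (axis i 1))"

definition local_defining_function ::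
    "(real ^ 'd) set \<Rightarrow> (real ^ 'd) set \<Rightarrow> (real ^ 'd \<Rightarrow> real) \<Rightarrow> bool" where
  "local_defining_function M U \<rho> \<longleftrightarrow>
     open U \<and> smooth_on U \<rho> \<and> (\<forall>x\<in>U. gradient \<rho> x \<noteq> 0) \<and> M \<inter> U = {x \<in> U. \<rho> x = 0}"

definition smooth_hypersurface :: "(real ^ 'd) set \<Rightarrow> bool" where
  "smooth_hypersurface M \<longleftrightarrow> (\<forall>p\<in>M. \<exists>U \<rho>. p \<in> U \<and> local_defining_function M U \<rho>)"

definition unit_normal :: "(real ^ 'd \<Rightarrow> real) \<Rightarrow> real ^ 'd \<Rightarrow> real ^ 'd" where
  "unit_normal \<rho> x = gradient \<rho> x /\<^sub>R norm (gradient \<rho> x)"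

text \<open>The Gaussian curvature of \<open>{\<rho> = 0}\<close> at \<open>p\<close> is the determinant of the Weingarten map
  \<open>v \<mapsto> DN(p) v\<close> on the tangent space \<open>N(p)\<^sup>\<bottom>\<close>, where \<open>N\<close> is the unit normal. In order to use the
  determinant of a matrix, this map is extended to the whole space by the identity on the
  normal line, which does not change the determinant: a vector \<open>v\<close> with normal component
  \<open>w = (v \<bullet> N(p)) N(p)\<close> is sent to \<open>DN(p) (v - w) + w\<close>. The choice of \<open>\<rho>\<close> affects the result
  by at most a sign.\<close>

definition gaussian_curvature :: "(real ^ 'd \<Rightarrow> real) \<Rightarrow> real ^ 'd \<Rightarrow> real" where
  "gaussian_curvature \<rho> p =
     det (matrix (\<lambda>v. let w = (v \<bullet> unit_normal \<rho> p) *\<^sub>R unit_normal \<rho> p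
                      in frechet_derivative (unit_normal \<rho>) (at p) (v - w) + w))"

definition nonvanishing_gaussian_curvature :: "(real ^ 'd) set \<Rightarrow> bool" where
  "nonvanishing_gaussian_curvature M \<longleftrightarrow>
     (\<forall>p\<in>M. \<exists>U \<rho>. p \<in> U \<and> local_defining_function M U \<rho> \<and> gaussian_curvature \<rho> p \<noteq> 0)"

section \<open>Energy integrals\<close>

text \<open>The value on the diagonal is spelled out because \<open>0 powr a = 0\<close> for every \<open>a\<close>.\<close>

definition riesz_kernel :: "real \<Rightarrow> 'a::euclidean_space \<Rightarrow> 'a \<Rightarrow> ennreal" where
  "riesz_kernel s x y =
     (if x \<noteq> y then ennreal (norm (x - y) powr (- s))
      else if s > 0 then \<infinity> else if s = 0 then 1 else 0)"

definition energy :: "real \<Rightarrow> 'a::euclidean_space measure \<Rightarrow> ennreal" where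
  "energy s \<mu> = (\<integral>\<^sup>+ x. (\<integral>\<^sup>+ y. riesz_kernel s x y \<partial>\<mu>) \<partial>\<mu>)"

end

theory Submission
  imports Defs
begin

text \<open>Let \<open>\<phi>\<close> be an even smooth convex function that equals \<open>\<bar>z\<bar>\<close> for \<open>\<bar>z\<bar> \<ge> 1\<close> and has a positive
  second derivative on \<open>(-1, 1)\<close>. The body \<open>B = {(y, z). \<bar>y\<bar>\<^sup>2 + \<phi> z \<le> 8}\<close> has a smooth boundary of
  nonvanishing curvature, and where \<open>z \<ge> 1\<close> the boundary is the paraboloid \<open>z = 8 - \<bar>y\<bar>\<^sup>2\<close>.

  The paraboloid is compatible with the lattice with spacing \<open>1 / L\<close> in the \<open>d - 1\<close> horizontal
  directions and \<open>1 / L\<^sup>2\<close> in the vertical one: if \<open>a\<close>, \<open>b\<close> are integer vectors of size about \<open>L\<close>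
  with \<open>\<langle>a, b\<rangle> = 4 L\<^sup>2\<close>, then the lattice vectors \<open>v\<close>, \<open>w\<close> of the paraboloid over \<open>a / L\<close> and
  \<open>- b / L\<close> have a sum on the paraboloid, so that \<open>p\<close>, \<open>p + w\<close>, \<open>p + w + v\<close> are at mutual
  \<open>B\<close>-distance \<open>1\<close>. By pigeonhole some value \<open>4 L\<^sup>2\<close> of the inner product is attained by at least
  about \<open>L\<^bsup>2(d-1)-2\<^esup>\<close> pairs, and \<open>L\<close> is chosen accordingly.

  Spread unit mass over boxes of side \<open>\<epsilon> = L powr (- \<kappa>)\<close> at the about \<open>L\<^bsup>d+1\<^esup>\<close> lattice points of a
  bounded region. Its \<open>s\<close>-potential is bounded uniformly in \<open>L\<close> when \<open>\<kappa> s < d + 1\<close>, while the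
  triples have measure about \<open>L\<^bsup>-6\<^esup>\<close>, which for \<open>\<kappa> > 2\<close> is much larger than \<open>\<epsilon>\<^sup>3\<close>. For
  \<open>s < (d + 1) / 2\<close> both conditions on \<open>\<kappa>\<close> can be met, and a weighted sum of these measures over a
  sparse sequence of values of \<open>L\<close> is the desired measure.\<close>

section \<open>A smooth convex function equal to the absolute value outside an interval\<close>

text \<open>Differentiation sends \<open>bump_term P m\<close> to \<open>bump_term (bump_step P m) (m + 2)\<close>, so all derivatives
  of \<open>bump_term 1 0\<close> are of this form.\<close>

definition bump_term :: "real poly \<Rightarrow> nat \<Rightarrow> real \<Rightarrow> real" where
  "bump_term P m x = (if \<bar>x\<bar> < 1 then poly P x / (1 - x\<^sup>2) ^ m * exp (- 1 / (1 - x\<^sup>2)) else 0)"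

definition bump_step :: "real poly \<Rightarrow> nat \<Rightarrow> real poly" where
  "bump_step P m = pderiv P * [:1, 0, -1:]\<^sup>2 + smult (2 * real m) [:0, 1:] * P * [:1, 0, -1:] - [:0, 2:] * P"

text \<open>The exponential series at \<open>1 / w\<close> dominates its term of order
  \<open>m + 2\<close>. The two powers of \<open>w\<close> to spare later force derivative zero at
  the endpoints of the interval.\<close>

lemma exp_inverse_le_power:
  fixes w :: real
  assumes "0 < w"
  shows "exp (- 1 / w) / w ^ m \<le> fact (m + 2) * w\<^sup>2"
proof -
  have "(1 / w) ^ (m + 2) / fact (m + 2) \<le> exp (1 / w)"
  proof -
    have "(\<Sum>n\<in>{m + 2}. (1 / w) ^ n /\<^sub>R fact n) \<le> (\<Sum>n. (1 / w) ^ n /\<^sub>R fact n)"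
      using assms by (intro sum_le_suminf summable_exp_generic) auto
    then show ?thesis by (simp add: exp_def divide_inverse mult.commute)
  qed
  then have "exp (- 1 / w) * ((1 / w) ^ (m + 2) / fact (m + 2)) \<le> exp (- 1 / w) * exp (1 / w)"
    by (intro mult_left_mono) auto
  also have "\<dots> = 1" by (simp flip: exp_add)
  finally have *: "exp (- 1 / w) * ((1 / w) ^ (m + 2) / fact (m + 2)) \<le> 1" .
  define F :: real where "F = fact (m + 2)"
  have "F > 0" by (simp add: F_def)
  then show ?thesis
    using * assms unfolding F_def[symmetric] by (simp add: field_simps power_add power2_eq_square)
qed

text \<open>Vanishing to second order at 1 and -1 makes the difference quotients there tend to zero,
  whatever the polynomial and the order of the pole.\<close>

lemma bump_term_bound:
  "\<exists>C. \<forall>x. \<bar>bump_term P m x\<bar> \<le> C * \<bar>1 - x\<^sup>2\<bar>\<^sup>2"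
proof -
  have "bounded (poly P ` {-1..1})"
    by (intro compact_imp_bounded compact_continuous_image continuous_intros) auto
  then obtain K where K: "\<And>x. \<bar>x\<bar> \<le> 1 \<Longrightarrow> \<bar>poly P x\<bar> \<le> K"
    unfolding bounded_iff by fastforce
  have "\<bar>bump_term P m x\<bar> \<le> (\<bar>K\<bar> * fact (m + 2)) * \<bar>1 - x\<^sup>2\<bar>\<^sup>2" for x
  proof (cases "\<bar>x\<bar> < 1")
    case True
    then have w: "0 < 1 - x\<^sup>2" by (simp add: abs_square_less_1)
    have "\<bar>bump_term P m x\<bar> = \<bar>poly P x\<bar> * (exp (- 1 / (1 - x\<^sup>2)) / (1 - x\<^sup>2) ^ m)"
      using True w by (simp add: bump_term_def abs_mult)
    also have "\<dots> \<le> \<bar>K\<bar> * (fact (m + 2) * (1 - x\<^sup>2)\<^sup>2)"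
      using K[of x] True exp_inverse_le_power[OF w, of m] w by (intro mult_mono) auto
    finally show ?thesis by simp
  qed (simp add: bump_term_def)
  then show ?thesis by blast
qed

lemma bump_term_has_derivative:
  "(bump_term P m has_real_derivative bump_term (bump_step P m) (m + 2) x) (at x)"
proof -
  consider "\<bar>x\<bar> < 1" | "\<bar>x\<bar> > 1" | "\<bar>x\<bar> = 1" by linarith
  then show ?thesis
  proof cases
    case 1
    then have w: "0 < 1 - x\<^sup>2" by (simp add: abs_square_less_1)
    let ?f = "\<lambda>x. poly P x / (1 - x\<^sup>2) ^ m * exp (- 1 / (1 - x\<^sup>2))"
    have ev: "\<forall>\<^sub>F y in nhds x. y \<in> {-1<..<1}"
      using 1 by (intro eventually_nhds_in_open) auto
    have 2: "(?f has_real_derivative bump_term (bump_step P m) (m + 2) x) (at x)"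
    proof -
      define w where "w = 1 - x\<^sup>2"
      have w0: "w > 0" using w by (simp add: w_def)
      have pow: "((\<lambda>x. (1 - x\<^sup>2) ^ m) has_real_derivative - (2 * real m * x * w ^ m / w)) (at x)"
        proof (cases m)
        case (Suc j)
        show ?thesis unfolding Suc
          by (rule derivative_eq_intros refl)+ (use w0 in \<open>simp add: w_def field_simps\<close>)
      qed simp
      have ex: "((\<lambda>x. exp (- 1 / (1 - x\<^sup>2))) has_real_derivative - (2 * x / w\<^sup>2) * exp (- 1 / w)) (at x)"
        using w0 by (auto intro!: derivative_eq_intros simp: w_def power2_eq_square)
      have "(?f has_real_derivative
          (poly (pderiv P) x * w ^ m + poly P x * (2 * real m * x * w ^ m / w)) / (w ^ m * w ^ m)
            * exp (- 1 / w) + poly P x / w ^ m * (- (2 * x / w\<^sup>2) * exp (- 1 / w))) (at x)"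
        using w0 by (intro DERIV_cong[OF DERIV_mult[OF DERIV_divide[OF poly_DERIV pow] ex]])
          (simp_all add: mult_ac flip: w_def)
      moreover have "poly (bump_step P m) x = poly (pderiv P) x * w\<^sup>2 + 2 * real m * x * poly P x * w - 2 * x * poly P x"
        by (simp add: bump_step_def w_def power2_eq_square algebra_simps)
      then have "bump_term (bump_step P m) (m + 2) x =
          (poly (pderiv P) x * w ^ m + poly P x * (2 * real m * x * w ^ m / w)) / (w ^ m * w ^ m)
            * exp (- 1 / w) + poly P x / w ^ m * (- (2 * x / w\<^sup>2) * exp (- 1 / w))"
        using 1 w0 by (simp add: bump_term_def flip: w_def) (simp add: field_simps power_add power2_eq_square)
      ultimately show ?thesis by simp
    qed
    show ?thesis
      by (rule DERIV_cong_ev[THEN iffD1, OF refl _ refl 2])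
         (use ev in eventually_elim, auto simp: bump_term_def)
  next
    case 2
    have ev: "\<forall>\<^sub>F y in nhds x. y \<in> {..<-1} \<union> {1<..}"
      using 2 by (intro eventually_nhds_in_open) (auto simp: abs_if split: if_splits)
    have "((\<lambda>_. 0) has_real_derivative bump_term (bump_step P m) (m + 2) x) (at x)"
      using 2 by (simp add: bump_term_def)
    then show ?thesis
      by (rule DERIV_cong_ev[THEN iffD1, OF refl _ refl, rotated])
         (use ev in eventually_elim, auto simp: bump_term_def)
  next
    case 3
    obtain C where C: "\<And>y. \<bar>bump_term P m y\<bar> \<le> C * \<bar>1 - y\<^sup>2\<bar>\<^sup>2"
      using bump_term_bound by metis
    have x2: "x\<^sup>2 = 1" using 3 by (metis power2_abs power_one)
    \<comment> \<open>Since \<open>x\<^sup>2 = 1\<close>, the bound contains the square of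
      \<open>(x - y) * (x + y)\<close>; dividing it by \<open>\<bar>y - x\<bar>\<close> still leaves
      one factor \<open>x - y\<close>.\<close>
    have "((\<lambda>y. C * \<bar>(x - y) * (x + y)\<^sup>2\<bar>) \<longlongrightarrow> C * \<bar>(x - x) * (x + x)\<^sup>2\<bar>) (at x)"
      by (intro tendsto_intros)
    then have lim: "((\<lambda>y. C * \<bar>(x - y) * (x + y)\<^sup>2\<bar>) \<longlongrightarrow> 0) (at x)" by simp
    have "((\<lambda>y. (bump_term P m y - bump_term P m x) / (y - x)) \<longlongrightarrow> 0) (at x)"
    proof (rule Lim_null_comparison[OF _ lim], rule eventually_at_ball'[of 1, THEN eventually_mono])
      fix y assume y: "y \<in> ball x 1 \<and> y \<noteq> x \<and> y \<in> UNIV"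
      have "1 - y\<^sup>2 = (x - y) * (x + y)" using x2 by (simp add: algebra_simps power2_eq_square)
      then have "\<bar>bump_term P m y\<bar> \<le> C * \<bar>(x - y) * (x + y)\<bar>\<^sup>2" using C[of y] by simp
      also have "\<dots> = C * \<bar>(x - y) * (x + y)\<^sup>2\<bar> * \<bar>y - x\<bar>"
        by (simp add: abs_mult power2_eq_square abs_minus_commute)
      finally show "norm ((bump_term P m y - bump_term P m x) / (y - x)) \<le> C * \<bar>(x - y) * (x + y)\<^sup>2\<bar>"
        using y 3 by (simp add: bump_term_def[of P m x] pos_divide_le_eq)
    qed auto
    then show ?thesis
      using 3 by (simp add: has_field_derivative_iff bump_term_def[of "bump_step P m"])
  qed
qed

primrec bump_coeff :: "nat \<Rightarrow> real poly" where
  "bump_coeff 0 = 1"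
| "bump_coeff (Suc n) = bump_step (bump_coeff n) (2 * n)"

definition bump :: "nat \<Rightarrow> real \<Rightarrow> real" where
  "bump n = bump_term (bump_coeff n) (2 * n)"

lemma bump_has_derivative: "(bump n has_real_derivative bump (Suc n) x) (at x)"
  using bump_term_has_derivative[of "bump_coeff n" "2 * n" x] by (simp add: bump_def)

lemma bump_0: "bump 0 x = (if \<bar>x\<bar> < 1 then exp (- 1 / (1 - x\<^sup>2)) else 0)"
  by (simp add: bump_def bump_term_def)

section \<open>Construction of the smoothed absolute value\<close>

lemma real_antiderivative:
  fixes f :: "real \<Rightarrow> real"
  assumes "\<And>x. isCont f x"
  obtains F where "\<And>x. (F has_real_derivative f x) (at x)"
proof -
  have "\<exists>F. \<forall>x::real. - \<infinity> < ereal x \<longrightarrow> ereal x < \<infinity> \<longrightarrow> (F has_vector_derivative f x) (at x)"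
    using assms by (intro einterval_antiderivative) auto
  then show ?thesis
    using that by (auto simp: has_real_derivative_iff_has_vector_derivative)
qed

text \<open>The bump is integrated twice, scaled so that the slope reaches 1 at 1; the index of
  \<open>\<phi>\<close> is the order of differentiation. The last property holds because the bump is
  positive inside the interval and the slope is 1 or -1 outside it. The nonvanishing of the
  curvature will rest on it.\<close>

lemma smooth_abs_exists:
  obtains \<phi> :: "nat \<Rightarrow> real \<Rightarrow> real" where
    "\<And>n x. (\<phi> n has_real_derivative \<phi> (Suc n) x) (at x)"
    "\<And>x. \<phi> 0 (- x) = \<phi> 0 x" "\<And>x. \<bar>x\<bar> \<ge> 1 \<Longrightarrow> \<phi> 0 x = \<bar>x\<bar>"
    "\<And>x. \<phi> 2 x \<ge> 0" "\<And>x. \<phi> 2 x > 0 \<or> \<phi> 1 x \<noteq> 0"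
proof -
  obtain G where G: "\<And>x. (G has_real_derivative bump 0 x) (at x)"
    using real_antiderivative[of "bump 0"] DERIV_isCont[OF bump_has_derivative] by blast
  have zero: "f x = f 0" if "\<And>x. (f has_real_derivative 0) (at x)" for f :: "real \<Rightarrow> real" and x
    using DERIV_isconst_all that by blast
  \<comment> \<open>The antiderivative of the even bump that vanishes at 0 is odd, which makes its
    own antiderivative even.\<close>
  define H where "H x = G x - G 0" for x
  have H: "(H has_real_derivative bump 0 x) (at x)" for x
    unfolding H_def by (auto intro!: derivative_eq_intros G)
  have H_odd: "H (- x) = - H x" for x
  proof -
    have "H x + H (- x) = H 0 + H (- 0)"
      by (rule zero[of "\<lambda>x. H x + H (- x)"])
        (auto intro!: derivative_eq_intros H DERIV_chain2[where g = uminus, OF H] simp: bump_0)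
    then show ?thesis by (simp add: H_def)
  qed
  define c where "c = H 1"
  have H_mono: "H x < H y" if "x < y" "-1 \<le> x" "y \<le> 1" for x y
    using that by (intro DERIV_pos_imp_increasing_open[of x y H])
      (auto intro!: exI H continuous_at_imp_continuous_on DERIV_isCont[OF H] simp: bump_0)
  have c: "c > 0" using H_mono[of 0 1] by (simp add: c_def H_def)
  have H_ge: "H x = c" if "x \<ge> 1" for x
  proof (cases "x = 1")
    case False
    then show ?thesis unfolding c_def using that
      by (intro DERIV_isconst_end)
         (auto intro!: continuous_at_imp_continuous_on DERIV_isCont[OF H] DERIV_cong[OF H] simp: bump_0)
  qed (simp add: c_def)
  define h where "h x = H x / c" for x
  have h: "(h has_real_derivative bump 0 x / c) (at x)" for x
    unfolding h_def using c by (auto intro!: derivative_eq_intros H)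
  obtain K where K: "\<And>x. (K has_real_derivative h x) (at x)"
    using real_antiderivative[of h] DERIV_isCont[OF h] by blast
  \<comment> \<open>The constant makes \<open>k 1 = 1\<close>, so that slope 1 to the right of 1
    gives \<open>k x = x\<close> there.\<close>
  define k where "k x = K x - K 1 + 1" for x
  have k: "(k has_real_derivative h x) (at x)" for x
    unfolding k_def by (auto intro!: derivative_eq_intros K)
  have k_even: "k (- x) = k x" for x
  proof -
    have "k x - k (- x) = k 0 - k (- 0)"
      by (rule zero[of "\<lambda>x. k x - k (- x)"])
        (auto intro!: derivative_eq_intros k DERIV_chain2[where g = uminus, OF k] simp: h_def H_odd)
    then show ?thesis by simp
  qed
  have k_ge: "k x = x" if "x \<ge> 1" for x
  proof (cases "x = 1")
    case False
    have k': "((\<lambda>x. k x - x) has_real_derivative h x - 1) (at x)" for x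
      by (auto intro!: derivative_eq_intros k)
    have "k x - x = k 1 - 1" using that False c
      by (intro DERIV_isconst_end[of 1 x "\<lambda>x. k x - x"])
         (auto intro!: continuous_at_imp_continuous_on DERIV_isCont[OF k'] DERIV_cong[OF k'] simp: h_def H_ge)
    then show ?thesis by (simp add: k_def)
  qed (simp add: k_def)
  define \<phi> where "\<phi> n = (case n of 0 \<Rightarrow> k | Suc 0 \<Rightarrow> h | Suc (Suc n) \<Rightarrow> (\<lambda>x. bump n x / c))" for n
  show ?thesis
  proof (rule that[of \<phi>])
    show "(\<phi> n has_real_derivative \<phi> (Suc n) x) (at x)" for n x
      unfolding \<phi>_def using c by (auto intro!: derivative_eq_intros k h bump_has_derivative split: nat.split)
    show "\<phi> 0 (- x) = \<phi> 0 x" for x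
      by (simp add: \<phi>_def k_even)
    show "\<phi> 0 x = \<bar>x\<bar>" if "\<bar>x\<bar> \<ge> 1" for x
      using k_ge[of "\<bar>x\<bar>"] that k_even[of x] by (auto simp: \<phi>_def abs_if split: if_splits)
    show "\<phi> 2 x \<ge> 0" for x
      using c by (simp add: \<phi>_def numeral_2_eq_2 bump_0)
    show "\<phi> 2 x > 0 \<or> \<phi> 1 x \<noteq> 0" for x
    proof (cases "\<bar>x\<bar> < 1")
      case False
      then have "\<bar>H x\<bar> = c"
        using H_ge[of x] H_ge[of "- x"] H_odd[of x] c by (auto simp: abs_if split: if_splits)
      then show ?thesis using c by (auto simp: \<phi>_def h_def)
    qed (use c in \<open>simp add: \<phi>_def numeral_2_eq_2 bump_0\<close>)
  qed
qed

section \<open>Convex bodies with separable defining functions\<close>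

lemma body_norm_diff_le:
  fixes B :: "'a::euclidean_space set"
  assumes "symmetric_convex_body B"
  shows "\<exists>C>0. \<forall>x y. \<bar>body_norm B x - body_norm B y\<bar> \<le> C * norm (x - y)"
proof -
  obtain r where r: "r > 0" "ball 0 r \<subseteq> B" using symmetric_convex_body_zero_interior[OF assms] .
  have le: "body_norm B x \<le> 2 / r * norm x" for x
  proof (cases "x = 0")
    case False
    \<comment> \<open>With the factor 2, \<open>x /\<^sub>R t\<close> has norm \<open>r / 2\<close>
      and lies in the open ball.\<close>
    define t where "t = 2 / r * norm x"
    have t: "t > 0" using r False by (simp add: t_def)
    have "x /\<^sub>R t \<in> ball 0 r" using r False by (simp add: t_def)
    then have "x /\<^sub>R t \<in> B" using r by blast
    moreover have "x = t *\<^sub>R (x /\<^sub>R t)" using t by simp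
    ultimately have "x \<in> (*\<^sub>R) t ` B" by blast
    then show ?thesis using body_norm_le_iff[OF assms t, of x] by (simp add: t_def)
  qed (use body_norm_eq_zero_iff[OF assms, of 0] in simp)
  have "body_norm B x - body_norm B y \<le> 2 / r * norm (x - y)" for x y
    using body_norm_triangle[OF assms, of "x - y" y] le[of "x - y"] by simp
  from this this[of y x for x y] have "\<bar>body_norm B x - body_norm B y\<bar> \<le> 2 / r * norm (x - y)" for x y
    by (smt (verit) norm_minus_commute)
  then show ?thesis using r by (intro exI[of _ "2 / r"]) simp
qed

text \<open>If \<open>f x = c\<close> at an interior point \<open>x\<close>, the segment from
  \<open>y\<close> to \<open>x\<close> can be prolonged a little beyond \<open>x\<close> inside the
  sublevel set. Convexity along it, with the strict inequality at \<open>y\<close>, would give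
  \<open>f x < c\<close>.\<close>

lemma frontier_convex_sublevel:
  fixes f :: "'a::real_normed_vector \<Rightarrow> real"
  assumes conv: "convex_on UNIV f" and cont: "continuous_on UNIV f" and y: "f y < c"
  shows "frontier {x. f x \<le> c} = {x. f x = c}"
proof -
  have closed: "closed {x. f x \<le> c}" and op: "open {x. f x < c}"
    using cont by (auto intro!: closed_Collect_le open_Collect_less)
  have "{x. f x < c} \<subseteq> interior {x. f x \<le> c}"
    using op by (intro interior_maximal) auto
  moreover have "f x \<noteq> c" if "x \<in> interior {x. f x \<le> c}" for x
  proof
    assume fx: "f x = c"
    have "((\<lambda>t. x + t *\<^sub>R (x - y)) \<longlongrightarrow> x + 0 *\<^sub>R (x - y)) (at_right 0)"
      by (intro tendsto_intros)
    then have "\<forall>\<^sub>F t in at_right 0. x + t *\<^sub>R (x - y) \<in> interior {x. f x \<le> c}"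
      using that by (intro topological_tendstoD) auto
    moreover have "\<forall>\<^sub>F t::real in at_right 0. 0 < t" by (simp add: eventually_at_right_less)
    ultimately have "\<forall>\<^sub>F t in at_right 0. 0 < t \<and> x + t *\<^sub>R (x - y) \<in> interior {x. f x \<le> c}"
      by eventually_elim auto
    then obtain t where t: "0 < t" "x + t *\<^sub>R (x - y) \<in> interior {x. f x \<le> c}"
      by (metis (mono_tags, lifting) eventually_happens trivial_limit_at_right_real)
    \<comment> \<open>This solves \<open>(1 - s) * t = s\<close> and so writes \<open>x\<close> as a
      convex combination of the prolonged point and \<open>y\<close>.\<close>
    define s where "s = t / (1 + t)"
    have s: "0 < s" "s < 1" "(1 - s) * t = s" using t(1) by (auto simp: s_def field_simps)
    have "(1 - s) *\<^sub>R (x + t *\<^sub>R (x - y)) + s *\<^sub>R y = x + ((1 - s) * t - s) *\<^sub>R (x - y)"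
      by (simp add: algebra_simps)
    then have "(1 - s) *\<^sub>R (x + t *\<^sub>R (x - y)) + s *\<^sub>R y = x" using s by simp
    then have "f x \<le> (1 - s) * f (x + t *\<^sub>R (x - y)) + s * f y"
      using convex_onD[OF conv, of s "x + t *\<^sub>R (x - y)" y] s by auto
    also have "\<dots> < (1 - s) * c + s * c"
      using t(2) interior_subset y s by (intro add_le_less_mono mult_left_mono mult_strict_left_mono) auto
    finally show False using fx by (simp add: algebra_simps)
  qed
  ultimately show ?thesis
    using interior_subset[of "{x. f x \<le> c}"] unfolding frontier_def closure_closed[OF closed] by force
qed

text \<open>A norm below 1 would put \<open>x\<close> strictly between 0 and a point of the sublevel
  set, and convexity with \<open>f 0 < c\<close> would give \<open>f x < c\<close>.\<close>

lemma body_norm_sublevel_eq_1: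
  assumes B: "symmetric_convex_body {x. f x \<le> c}"
    and conv: "convex_on UNIV f" and 0: "f 0 < c" and x: "f x = c"
  shows "body_norm {x. f x \<le> c} x = 1"
proof (rule antisym)
  let ?B = "{x. f x \<le> c}"
  show "body_norm ?B x \<le> 1" using body_norm_le_iff[OF B, of 1 x] x by simp
  show "body_norm ?B x \<ge> 1"
  proof (rule ccontr)
    assume "\<not> ?thesis"
    then obtain t where t: "body_norm ?B x < t" "t < 1" using dense not_le by blast
    then have t0: "t > 0" using body_norm_nonneg[OF B, of x] by linarith
    then obtain y where y: "f y \<le> c" "x = t *\<^sub>R y"
      using body_norm_le_iff[OF B t0, of x] t by auto
    have "f x \<le> (1 - t) * f 0 + t * f y"
      using convex_onD[OF conv, of t 0 y] t t0 y by auto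
    also have "\<dots> < (1 - t) * c + t * c"
      using y 0 t t0 by (intro add_less_le_mono mult_left_mono mult_strict_left_mono) auto
    finally show False using x by (simp add: algebra_simps)
  qed
qed

section \<open>Smoothness and curvature of separable level sets\<close>

lemma Ck_on_subset: "Ck_on m U f \<Longrightarrow> V \<subseteq> U \<Longrightarrow> Ck_on m V f"
  by (induction m arbitrary: f) (auto intro: continuous_on_subset)

text \<open>\<open>\<psi> i n\<close> is the \<open>n\<close>-th derivative of the
  \<open>i\<close>-th summand of the defining function, so smoothness is built into
  \<open>deriv\<close>. Coercivity makes the body bounded. A vanishing second derivative is allowed
  only in coordinate \<open>k\<close>, where the slope must then be nonzero.\<close>

locale separable_body =
  fixes \<psi> :: "'d::finite \<Rightarrow> nat \<Rightarrow> real \<Rightarrow> real" and k :: 'd and c :: real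
  assumes deriv: "\<And>i n x. (\<psi> i n has_real_derivative \<psi> i (Suc n) x) (at x)"
    and even: "\<And>i x. \<psi> i 0 (- x) = \<psi> i 0 x"
    and coercive: "\<And>i x. \<psi> i 0 x \<ge> \<bar>x\<bar> - 1"
    and second_nonneg: "\<And>i x. \<psi> i 2 x \<ge> 0"
    and second_pos: "\<And>i x. i \<noteq> k \<Longrightarrow> \<psi> i 2 x > 0"
    and nondegenerate: "\<And>x. \<psi> k 2 x > 0 \<or> \<psi> k 1 x \<noteq> 0"
    and level: "(\<Sum>i\<in>UNIV. \<psi> i 0 0) < c"
begin

definition \<Psi> :: "real ^ 'd \<Rightarrow> real" where "\<Psi> x = (\<Sum>i\<in>UNIV. \<psi> i 0 (x $ i))"

definition G :: "real ^ 'd \<Rightarrow> real ^ 'd" where "G x = (\<chi> i. \<psi> i 1 (x $ i))"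

definition body :: "(real ^ 'd) set" where "body = {x. \<Psi> x \<le> c}"

lemma coordinate_has_derivative:
  "((\<lambda>x. \<psi> i n (x $ i)) has_derivative (\<lambda>h. \<psi> i (Suc n) (x $ i) * h $ i)) (at x)"
proof -
  have "(\<psi> i n has_derivative (*) (\<psi> i (Suc n) (x $ i))) (at (x $ i))"
    using deriv by (simp add: has_field_derivative_def)
  moreover have "((\<lambda>x. x $ i) has_derivative (\<lambda>h. h $ i)) (at x)"
    by (intro bounded_linear_imp_has_derivative bounded_linear_vec_nth)
  ultimately show ?thesis
    using has_derivative_compose by blast
qed

lemma \<Psi>_has_derivative: "(\<Psi> has_derivative (\<lambda>h. G x \<bullet> h)) (at x)"
proof -
  have "(\<Psi> has_derivative (\<lambda>h. \<Sum>i\<in>UNIV. \<psi> i (Suc 0) (x $ i) * h $ i)) (at x)"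
    unfolding \<Psi>_def by (intro has_derivative_sum coordinate_has_derivative)
  then show ?thesis by (simp add: G_def inner_vec_def)
qed

lemma \<rho>_has_derivative: "((\<lambda>x. \<Psi> x - c) has_derivative (\<lambda>h. G x \<bullet> h)) (at x)"
  by (auto intro!: derivative_eq_intros \<Psi>_has_derivative)

lemma gradient_\<rho>: "gradient (\<lambda>x. \<Psi> x - c) x = G x"
  unfolding gradient_def frechet_derivative_at[OF \<rho>_has_derivative, symmetric]
  by (simp add: vec_eq_iff inner_axis)

lemma continuous_on_\<Psi>: "continuous_on S \<Psi>"
  using \<Psi>_has_derivative by (meson continuous_at_imp_continuous_on has_derivative_continuous)

text \<open>The factor \<open>a\<close> is there for the induction: differentiating in direction
  \<open>b\<close> multiplies it by \<open>b $ i\<close> and raises \<open>n\<close>.\<close>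

lemma Ck_on_coordinate: "Ck_on m UNIV (\<lambda>x. a * \<psi> i n (x $ i))"
proof (induction m arbitrary: a n)
  case 0
  have "continuous_on UNIV (\<lambda>x. \<psi> i n (x $ i))"
    using coordinate_has_derivative by (meson continuous_at_imp_continuous_on has_derivative_continuous)
  then show ?case by (auto intro!: continuous_intros)
next
  case (Suc m)
  have D: "((\<lambda>x. a * \<psi> i n (x $ i)) has_derivative (\<lambda>h. a * (\<psi> i (Suc n) (x $ i) * h $ i))) (at x)" for x
    by (intro has_derivative_mult_right coordinate_has_derivative)
  have "Ck_on m UNIV (\<lambda>x. frechet_derivative (\<lambda>x. a * \<psi> i n (x $ i)) (at x) b)" for b
    using Suc[of "a * b $ i" "Suc n"]
    by (simp add: frechet_derivative_at[OF D, symmetric] mult_ac)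
  then show ?case using D by (auto simp: differentiable_def)
qed

lemma smooth_\<rho>: "smooth_on UNIV (\<lambda>x. \<Psi> x - c)"
  unfolding smooth_on_def
proof
  fix m
  have "Ck_on m UNIV (\<lambda>x. frechet_derivative (\<lambda>x. \<Psi> x - c) (at x) b)" if b: "b \<in> Basis" for m b
  proof -
    obtain j where b: "b = axis j 1" using b by (auto simp: Basis_vec_def)
    show ?thesis
      using Ck_on_coordinate[of m 1 j 1]
      by (simp add: frechet_derivative_at[OF \<rho>_has_derivative, symmetric] b inner_axis G_def)
  qed
  then show "Ck_on m UNIV (\<lambda>x. \<Psi> x - c)"
    using \<rho>_has_derivative
    by (cases m) (auto simp: differentiable_def intro!: continuous_intros continuous_on_\<Psi>)
qed

lemma convex_coordinate: "convex_on UNIV (\<psi> i 0)"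
  using deriv[of i 0] deriv[of i 1] second_nonneg
  by (intro f''_ge0_imp_convex[of _ _ "\<psi> i 1" "\<psi> i 2"]) (auto simp: numeral_2_eq_2)

lemma convex_\<Psi>: "convex_on UNIV \<Psi>"
proof (rule convex_onI)
  fix t x y assume t: "0 < (t::real)" "t < 1"
  have "\<Psi> ((1 - t) *\<^sub>R x + t *\<^sub>R y) \<le> (\<Sum>i\<in>UNIV. (1 - t) * \<psi> i 0 (x $ i) + t * \<psi> i 0 (y $ i))"
    unfolding \<Psi>_def using convex_onD[OF convex_coordinate, of t] t by (intro sum_mono) auto
  then show "\<Psi> ((1 - t) *\<^sub>R x + t *\<^sub>R y) \<le> (1 - t) * \<Psi> x + t * \<Psi> y"
    by (simp add: \<Psi>_def sum.distrib sum_distrib_left)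
qed auto

lemma \<Psi>_0: "\<Psi> 0 < c"
  using level by (simp add: \<Psi>_def)

lemma symmetric_convex_body_body: "symmetric_convex_body body"
  unfolding symmetric_convex_body_def
proof (intro conjI ballI)
  show "convex body"
  proof (rule convexI)
    fix x y and u v :: real assume *: "x \<in> body" "y \<in> body" "0 \<le> u" "0 \<le> v" "u + v = 1"
    then have "\<Psi> (u *\<^sub>R x + v *\<^sub>R y) \<le> u * \<Psi> x + v * \<Psi> y"
      using convex_\<Psi> by (auto simp: convex_on_def)
    also have "\<dots> \<le> u * c + v * c"
      using * by (intro add_mono mult_left_mono) (auto simp: body_def)
    also have "\<dots> = c" using * by (simp flip: distrib_right)
    finally show "u *\<^sub>R x + v *\<^sub>R y \<in> body" by (simp add: body_def)
  qed
  have "norm x \<le> c + CARD('d)" if "x \<in> body" for x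
  proof -
    have "norm x \<le> (\<Sum>i\<in>UNIV. \<bar>x $ i\<bar>)" by (rule norm_le_l1_cart)
    also have "\<dots> \<le> (\<Sum>i\<in>UNIV. \<psi> i 0 (x $ i) + 1)"
      using coercive by (intro sum_mono) (auto simp: algebra_simps)
    also have "\<dots> \<le> c + CARD('d)"
      using that by (simp add: sum.distrib body_def \<Psi>_def)
    finally show ?thesis .
  qed
  moreover have "closed body"
    unfolding body_def by (intro closed_Collect_le continuous_on_\<Psi> continuous_intros)
  ultimately show "compact body"
    by (auto simp: compact_eq_bounded_closed bounded_iff)
  have "{x. \<Psi> x < c} \<subseteq> interior body"
    unfolding body_def
    by (intro interior_maximal open_Collect_less continuous_on_\<Psi> continuous_intros) auto
  then show "interior body \<noteq> {}" using \<Psi>_0 by auto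
  show "- x \<in> body" if "x \<in> body" for x
    using that by (simp add: body_def \<Psi>_def even)
qed

lemma frontier_body: "frontier body = {x. \<Psi> x = c}"
  unfolding body_def using convex_\<Psi> continuous_on_\<Psi> \<Psi>_0 by (rule frontier_convex_sublevel)

lemma body_norm_eq_1: "\<Psi> x = c \<Longrightarrow> body_norm body x = 1"
  using symmetric_convex_body_body convex_\<Psi> \<Psi>_0 unfolding body_def by (rule body_norm_sublevel_eq_1)

text \<open>A zero of the gradient would minimise each convex summand, giving
  \<open>\<Psi> x \<le> \<Psi> 0 < c\<close>.\<close>

lemma G_nonzero:
  assumes "\<Psi> x = c"
  shows "G x \<noteq> 0"
proof
  assume "G x = 0"
  then have G: "\<psi> i 1 (x $ i) = 0" for i by (simp add: G_def vec_eq_iff)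
  have "\<psi> i 0 (x $ i) \<le> \<psi> i 0 0" for i
    using convex_on_imp_above_tangent[OF convex_coordinate, of "x $ i" 0 i 0] deriv[of i 0 "x $ i"] G[of i]
    by simp
  then have "\<Psi> x \<le> \<Psi> 0" unfolding \<Psi>_def by (intro sum_mono) auto
  then show False using \<Psi>_0 assms by simp
qed

lemma G_has_derivative: "(G has_derivative (\<lambda>h. \<chi> i. \<psi> i 2 (x $ i) * h $ i)) (at x)"
  unfolding has_derivative_componentwise_within[of G]
proof
  fix b :: "real ^ 'd" assume "b \<in> Basis"
  then obtain j where b: "b = axis j 1" by (auto simp: Basis_vec_def)
  show "((\<lambda>x. G x \<bullet> b) has_derivative (\<lambda>h. (\<chi> i. \<psi> i 2 (x $ i) * h $ i) \<bullet> b)) (at x)"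
    using coordinate_has_derivative[of j 1 x] by (simp add: b inner_axis G_def numeral_2_eq_2)
qed

lemma continuous_on_G: "continuous_on S G"
  using G_has_derivative by (meson continuous_at_imp_continuous_on has_derivative_continuous)

lemma local_defining_function_\<rho>:
  "local_defining_function (frontier body) {x. G x \<noteq> 0} (\<lambda>x. \<Psi> x - c)"
proof -
  have "open {x. G x \<noteq> 0}" by (intro open_Collect_neq continuous_on_G continuous_intros)
  then show ?thesis
    using smooth_\<rho> unfolding local_defining_function_def smooth_on_def
    by (auto intro: Ck_on_subset simp: gradient_\<rho> frontier_body)
qed

lemma smooth_hypersurface_body: "smooth_hypersurface (frontier body)"
  unfolding smooth_hypersurface_def
proof
  fix p assume "p \<in> frontier body"
  then have "p \<in> {x. G x \<noteq> 0}" using G_nonzero frontier_body by simp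
  then show "\<exists>U \<rho>. p \<in> U \<and> local_defining_function (frontier body) U \<rho>"
    using local_defining_function_\<rho> by metis
qed

text \<open>A vector \<open>v\<close> killed by the Weingarten map is tangent, and the Hessian maps it to a multiple of
  the gradient, so the Hessian form vanishes at \<open>v\<close>. This form is definite in all directions but
  \<open>k\<close>, and \<open>v\<close> has no \<open>k\<close> component since there either the Hessian or the gradient is nonzero.\<close>

lemma gaussian_curvature_nonzero:
  assumes p: "\<Psi> p = c"
  shows "gaussian_curvature (\<lambda>x. \<Psi> x - c) p \<noteq> 0"
proof -
  define N where "N = unit_normal (\<lambda>x. \<Psi> x - c)"
  define H where "H h = (\<chi> i. \<psi> i 2 (p $ i) * h $ i)" for h :: "real ^ 'd"
  define r where "r = norm (G p)"
  have r: "r > 0" using G_nonzero[OF p] by (simp add: r_def)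
  have N: "N x = inverse (norm (G x)) *\<^sub>R G x" for x
    by (simp add: N_def unit_normal_def gradient_\<rho>)
  have H: "(G has_derivative H) (at p)" unfolding H_def by (rule G_has_derivative)
  have "(\<lambda>x. inverse (norm (G x))) differentiable (at p)"
    using H r unfolding r_def
    by (intro differentiable_inverse differentiable_compose[of norm G] differentiable_norm_at)
       (auto simp: differentiable_def)
  \<comment> \<open>The derivative of the normalising factor enters \<open>D\<close> only along
    \<open>G p\<close>, so it drops out when \<open>D v\<close> is paired with a tangent vector
    \<open>v\<close>.\<close>
  then obtain \<beta> where \<beta>: "((\<lambda>x. inverse (norm (G x))) has_derivative \<beta>) (at p)"
    by (auto simp: differentiable_def)
  define D where "D h = inverse r *\<^sub>R H h + \<beta> h *\<^sub>R G p" for h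
  have D: "(N has_derivative D) (at p)"
    unfolding N r_def D_def by (intro has_derivative_scaleR \<beta> H)
  \<comment> \<open>Differentiate \<open>N x \<bullet> N x = 1\<close>, which holds near
    \<open>p\<close>.\<close>
  have D_orth: "D h \<bullet> N p = 0" for h
  proof -
    have "((\<lambda>x. N x \<bullet> N x) has_derivative (\<lambda>h. N p \<bullet> D h + D h \<bullet> N p)) (at p)"
      by (intro has_derivative_inner D)
    moreover have "((\<lambda>x. N x \<bullet> N x) has_derivative (\<lambda>h. 0)) (at p)"
    proof (rule has_derivative_transform_within_open[where f = "\<lambda>_. 1"])
      show "open {x. G x \<noteq> 0}" by (intro open_Collect_neq continuous_on_G continuous_intros)
    qed (use G_nonzero[OF p] in \<open>auto simp: N dot_square_norm power2_eq_square\<close>)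
    ultimately have "(\<lambda>h. N p \<bullet> D h + D h \<bullet> N p) = (\<lambda>h. 0)"
      by (rule has_derivative_unique)
    then have "N p \<bullet> D h + D h \<bullet> N p = 0" by (rule fun_cong)
    then show ?thesis by (simp add: inner_commute)
  qed
  have Np: "N p \<bullet> N p = 1"
    using r by (simp add: N r_def dot_square_norm power2_eq_square)
  define T where "T v = (let w = (v \<bullet> N p) *\<^sub>R N p in frechet_derivative N (at p) (v - w) + w)" for v
  have T_eq: "T v = D (v - (v \<bullet> N p) *\<^sub>R N p) + (v \<bullet> N p) *\<^sub>R N p" for v
    by (simp add: T_def Let_def frechet_derivative_at[OF D, symmetric])
  have linD: "linear D" using D has_derivative_linear by blast
  have lin: "linear T"
    unfolding T_eq
    by (intro linearI) (auto simp: linear_add[OF linD] linear_diff[OF linD] linear_scale[OF linD] algebra_simps)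
  have "v = 0" if "T v = 0" for v
  proof -
    have "T v \<bullet> N p = v \<bullet> N p" by (simp add: T_eq inner_add_left D_orth Np)
    then have vN: "v \<bullet> N p = 0" using that by simp
    then have "D v = 0" using that by (simp add: T_eq)
    moreover have vG: "v \<bullet> G p = 0" using vN r by (simp add: N r_def)
    ultimately have "v \<bullet> H v = 0"
      using r by (metis D_def inner_add_right inner_scaleR_right inner_zero_right mult_eq_0_iff add.right_neutral
          inverse_nonzero_iff_nonzero less_irrefl)
    then have "(\<Sum>i\<in>UNIV. \<psi> i 2 (p $ i) * (v $ i)\<^sup>2) = 0"
      by (simp add: H_def inner_vec_def power2_eq_square mult_ac)
    then have z: "\<psi> i 2 (p $ i) * (v $ i)\<^sup>2 = 0" for i
      using second_nonneg by (subst (asm) sum_nonneg_eq_0_iff) auto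
    have vi: "v $ i = 0" if "i \<noteq> k" for i
      using z[of i] second_pos[OF that, of "p $ i"] by auto
    have "v \<bullet> G p = (\<Sum>i\<in>UNIV. v $ i * G p $ i)" by (simp add: inner_vec_def)
    also have "\<dots> = (\<Sum>i\<in>{k}. v $ i * G p $ i)"
      by (rule sum.mono_neutral_right) (auto simp: vi)
    finally have "v \<bullet> G p = v $ k * G p $ k" by simp
    then have "v $ k * \<psi> k 1 (p $ k) = 0" using vG by (simp add: G_def)
    then have "v $ k = 0" using nondegenerate[of "p $ k"] z[of k] by auto
    then show "v = 0" using vi by (metis vec_eq_iff zero_index)
  qed
  then have "inj T" using lin by (simp add: linear_injective_0)
  then have "det (matrix T) \<noteq> 0"
    using lin by (simp add: det_nz_iff_inj matrix_vector_mul(2))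
  then show ?thesis
    unfolding gaussian_curvature_def T_def N_def .
qed

lemma nonvanishing_gaussian_curvature_body: "nonvanishing_gaussian_curvature (frontier body)"
  unfolding nonvanishing_gaussian_curvature_def
proof
  fix p assume "p \<in> frontier body"
  then have "\<Psi> p = c" using frontier_body by simp
  then have "p \<in> {x. G x \<noteq> 0}" "gaussian_curvature (\<lambda>x. \<Psi> x - c) p \<noteq> 0"
    using G_nonzero gaussian_curvature_nonzero by auto
  then show "\<exists>U \<rho>. p \<in> U \<and> local_defining_function (frontier body) U \<rho> \<and> gaussian_curvature \<rho> p \<noteq> 0"
    using local_defining_function_\<rho> by metis
qed

end

section \<open>Potentials of thickened grids\<close>

lemma measurable_riesz_kernel [measurable]:
  "(\<lambda>y. riesz_kernel s x y) \<in> borel_measurable borel"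
  unfolding riesz_kernel_def by measurable

text \<open>Lowers the exponent at bounded distances, possibly to nonpositive values. On the
  diagonal the right-hand side is infinite because \<open>s' > 0\<close>.\<close>

lemma riesz_kernel_le_riesz_kernel:
  assumes "s \<le> s'" "s' > 0" "norm (x - y) \<le> D" "D \<ge> 1"
  shows "riesz_kernel s x y \<le> ennreal (D powr (s' - s)) * riesz_kernel s' x y"
proof (cases "x = y")
  case True
  then show ?thesis using assms by (simp add: riesz_kernel_def ennreal_mult_top)
next
  case False
  define r where "r = norm (x - y)"
  have r: "r > 0" using False by (simp add: r_def)
  have "r powr (- s) = r powr (s' - s) * r powr (- s')" by (simp flip: powr_add)
  also have "\<dots> \<le> D powr (s' - s) * r powr (- s')"
    using assms r by (intro mult_right_mono powr_mono2) (auto simp: r_def)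
  finally show ?thesis
    using False by (simp add: riesz_kernel_def r_def ennreal_leI flip: ennreal_mult)
qed

text \<open>The condition \<open>\<tau> < 1\<close> makes the singularity at \<open>x\<close>
  integrable; the two sides of \<open>x\<close> contribute equally.\<close>

lemma nn_integral_riesz_kernel_le:
  fixes x \<tau> R :: real
  assumes \<tau>: "0 < \<tau>" "\<tau> < 1" and R: "R \<ge> 0"
  shows "(\<integral>\<^sup>+ y. riesz_kernel \<tau> x y * indicator {x - R..x + R} y \<partial>lborel)
           \<le> ennreal (2 / (1 - \<tau>) * R powr (1 - \<tau>))"
proof -
  have half: "(\<integral>\<^sup>+ u. riesz_kernel \<tau> x (x + c * u) * indicator {0..R} u \<partial>lborel)
      = ennreal (R powr (1 - \<tau>) / (1 - \<tau>))" if "\<bar>c\<bar> = 1" for c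
  proof -
    have "(\<integral>\<^sup>+ u. riesz_kernel \<tau> x (x + c * u) * indicator {0..R} u \<partial>lborel)
        = (\<integral>\<^sup>+ u. ennreal (u powr (- \<tau>)) * indicator {0..R} u \<partial>lborel)"
    proof (rule nn_integral_cong_AE)
      show "AE u in lborel. riesz_kernel \<tau> x (x + c * u) * indicator {0..R} u
          = ennreal (u powr (- \<tau>)) * indicator {0..R} u"
        using AE_lborel_singleton[of 0]
        by eventually_elim (use that in \<open>auto simp: riesz_kernel_def abs_mult indicator_def\<close>)
    qed
    also have "\<dots> = ennreal (R powr (- \<tau> + 1) / (- \<tau> + 1))"
      using \<tau> R by (intro nn_integral_has_integral_lebesgue' has_integral_powr_from_0) auto
    finally show ?thesis by simp
  qed
  have "(\<integral>\<^sup>+ y. riesz_kernel \<tau> x y * indicator {x - R..x + R} y \<partial>lborel)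
      \<le> (\<integral>\<^sup>+ y. riesz_kernel \<tau> x y * indicator {0..R} (y - x)
              + riesz_kernel \<tau> x y * indicator {0..R} (x - y) \<partial>lborel)"
    by (intro nn_integral_mono) (auto simp: indicator_def)
  also have "\<dots> = (\<integral>\<^sup>+ y. riesz_kernel \<tau> x y * indicator {0..R} (y - x) \<partial>lborel)
              + (\<integral>\<^sup>+ y. riesz_kernel \<tau> x y * indicator {0..R} (x - y) \<partial>lborel)"
    by (intro nn_integral_add) measurable
  also have "(\<integral>\<^sup>+ y. riesz_kernel \<tau> x y * indicator {0..R} (y - x) \<partial>lborel)
      = ennreal (R powr (1 - \<tau>) / (1 - \<tau>))"
    using half[of 1] by (subst nn_integral_real_affine[where c = 1 and t = x]) auto
  also have "(\<integral>\<^sup>+ y. riesz_kernel \<tau> x y * indicator {0..R} (x - y) \<partial>lborel)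
      = ennreal (R powr (1 - \<tau>) / (1 - \<tau>))"
    using half[of "-1"] by (subst nn_integral_real_affine[where c = "-1" and t = x]) auto
  finally show ?thesis
    using \<tau> by (simp flip: ennreal_plus)
qed

text \<open>With the normalisation of \<open>grid_density\<close> every interval of the grid has mass \<open>1 / N\<close>.\<close>

definition grid :: "real \<Rightarrow> real \<Rightarrow> real \<Rightarrow> real set" where
  "grid M N \<epsilon> = (\<Union>j\<in>{j::int. \<bar>real_of_int j\<bar> \<le> M * N}. {real_of_int j / N..real_of_int j / N + \<epsilon>})"

definition grid_density :: "real \<Rightarrow> real \<Rightarrow> real \<Rightarrow> real \<Rightarrow> ennreal" where
  "grid_density M N \<epsilon> y = ennreal (1 / (N * \<epsilon>)) * indicator (grid M N \<epsilon>) y"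

lemma finite_int_abs_le: "finite {j::int. \<bar>real_of_int j\<bar> \<le> K}"
proof (rule finite_subset)
  show "{j::int. \<bar>real_of_int j\<bar> \<le> K} \<subseteq> {- \<lceil>K\<rceil>..\<lceil>K\<rceil>}"
    by (auto simp: abs_le_iff) linarith+
qed auto

lemma measurable_grid [measurable]: "grid M N \<epsilon> \<in> sets borel"
  unfolding grid_def using finite_int_abs_le by (intro sets.finite_UN) auto

lemma measurable_grid_density [measurable]: "grid_density M N \<epsilon> \<in> borel_measurable borel"
  unfolding grid_density_def by measurable

lemma grid_subset:
  assumes "N \<ge> 1" "\<epsilon> \<le> 1" "y \<in> grid M N \<epsilon>"
  shows "\<bar>y\<bar> \<le> M + 1"
proof -
  obtain j :: int where j: "\<bar>real_of_int j\<bar> \<le> M * N" "y \<in> {real_of_int j / N..real_of_int j / N + \<epsilon>}"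
    using assms(3) by (auto simp: grid_def)
  have "\<bar>real_of_int j / N\<bar> \<le> M" using j(1) assms(1) by (simp add: abs_divide pos_divide_le_eq)
  then show ?thesis using j(2) assms(2) unfolding atLeastAtMost_iff by linarith
qed

lemma riesz_kernel_ge_antimono:
  fixes x y :: real
  assumes "\<bar>x - y\<bar> \<le> D" "0 < D" "0 < \<tau>"
  shows "ennreal (D powr (- \<tau>)) \<le> riesz_kernel \<tau> x y"
  using assms by (auto simp: riesz_kernel_def intro!: ennreal_leI powr_mono2')

lemma riesz_kernel_le_antimono:
  fixes x y :: real
  assumes "D \<le> \<bar>x - y\<bar>" "0 < D" "0 < \<tau>"
  shows "riesz_kernel \<tau> x y \<le> ennreal (D powr (- \<tau>))"
  using assms by (auto simp: riesz_kernel_def intro!: ennreal_leI powr_mono2')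

text \<open>The constant is uniform in \<open>N\<close>, \<open>\<epsilon>\<close> and
  \<open>x\<close>. At most five intervals are near \<open>x\<close>, and each has bounded
  potential, because mass \<open>1 / N\<close> on length \<open>\<epsilon>\<close> produces at most
  the order of \<open>\<epsilon> powr (- \<tau>) / N\<close>. The other intervals act like Lebesgue
  measure on a bounded interval.\<close>

lemma grid_potential_bound:
  assumes \<tau>: "0 < \<tau>" "\<tau> < 1" and M: "M \<ge> 0"
  shows "\<exists>A::real. \<forall>N \<epsilon> x. N \<ge> 1 \<longrightarrow> 0 < \<epsilon> \<longrightarrow> \<epsilon> \<le> 1 / N \<longrightarrow> \<epsilon> powr (- \<tau>) \<le> N \<longrightarrow>
    (\<integral>\<^sup>+ y. riesz_kernel \<tau> x y * grid_density M N \<epsilon> y \<partial>lborel) \<le> ennreal A"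
proof (intro exI allI impI)
  define C1 C2 where "C1 = 2 / (1 - \<tau>) + 1" and "C2 = 2 / (1 - \<tau>) + (2 * M + 1)"
  have C: "C1 \<ge> 0" "C2 \<ge> 0" using \<tau> M by (auto simp: C1_def C2_def)
  fix N \<epsilon> x :: real
  assume N: "N \<ge> 1" and \<epsilon>: "0 < \<epsilon>" "\<epsilon> \<le> 1 / N" "\<epsilon> powr (- \<tau>) \<le> N"
  define J where "J = {j::int. \<bar>real_of_int j\<bar> \<le> M * N}"
  have J: "finite J" unfolding J_def by (rule finite_int_abs_le)
  define b where "b j = {real_of_int j / N..real_of_int j / N + \<epsilon>}" for j
  define cell where "cell j = {real_of_int j / N..<(real_of_int j + 1) / N}" for j
  define near where "near = {j. \<bar>x - real_of_int j / N\<bar> \<le> 2 / N}"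
  define I where "I j = (\<integral>\<^sup>+ y. riesz_kernel \<tau> x y * (ennreal (1 / (N * \<epsilon>)) * indicator (b j) y) \<partial>lborel)" for j
  have [measurable]: "b j \<in> sets borel" "cell j \<in> sets borel" for j by (simp_all add: b_def cell_def)
  have b_emeasure: "emeasure lborel (b j) = ennreal \<epsilon>" for j using \<epsilon> by (simp add: b_def)
  have I_near: "I j \<le> ennreal C1" for j
  proof -
    have "I j = ennreal (1 / (N * \<epsilon>)) * (\<integral>\<^sup>+ y. riesz_kernel \<tau> x y * indicator (b j) y \<partial>lborel)"
      unfolding I_def by (subst nn_integral_cmult[symmetric]) (auto simp: mult_ac)
    \<comment> \<open>Within distance \<open>\<epsilon>\<close> of \<open>x\<close> the singularity
      is integrated; farther away the kernel is at most
      \<open>\<epsilon> powr (- \<tau>)\<close>.\<close>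
    also have "(\<integral>\<^sup>+ y. riesz_kernel \<tau> x y * indicator (b j) y \<partial>lborel)
       \<le> (\<integral>\<^sup>+ y. riesz_kernel \<tau> x y * indicator {x - \<epsilon>..x + \<epsilon>} y
              + ennreal (\<epsilon> powr (- \<tau>)) * indicator (b j) y \<partial>lborel)"
    proof (rule nn_integral_mono)
      fix y show "riesz_kernel \<tau> x y * indicator (b j) y \<le> riesz_kernel \<tau> x y * indicator {x - \<epsilon>..x + \<epsilon>} y
              + ennreal (\<epsilon> powr (- \<tau>)) * indicator (b j) y"
        using riesz_kernel_le_antimono[of \<epsilon> x y \<tau>] \<epsilon> \<tau>
        by (cases "\<epsilon> \<le> \<bar>x - y\<bar>") (auto simp: indicator_def add_increasing)
    qed
    also have "\<dots> = (\<integral>\<^sup>+ y. riesz_kernel \<tau> x y * indicator {x - \<epsilon>..x + \<epsilon>} y \<partial>lborel)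
              + ennreal (\<epsilon> powr (- \<tau>)) * ennreal \<epsilon>"
      by (subst nn_integral_add) (auto simp: nn_integral_cmult b_emeasure)
    also have "\<dots> \<le> ennreal (2 / (1 - \<tau>) * \<epsilon> powr (1 - \<tau>)) + ennreal (\<epsilon> powr (- \<tau>)) * ennreal \<epsilon>"
      using \<tau> \<epsilon> by (intro add_right_mono nn_integral_riesz_kernel_le) auto
    also have "\<dots> = ennreal (C1 * (\<epsilon> * \<epsilon> powr (- \<tau>)))"
    proof -
      have "\<epsilon> powr (1 - \<tau>) = \<epsilon> * \<epsilon> powr (- \<tau>)"
        using \<epsilon> by (simp add: powr_diff powr_minus divide_inverse)
      then show ?thesis
        using \<tau> \<epsilon> by (simp add: C1_def algebra_simps flip: ennreal_mult ennreal_plus)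
    qed
    also have "ennreal (1 / (N * \<epsilon>)) * \<dots> = ennreal (C1 * (\<epsilon> powr (- \<tau>) / N))"
      using C N \<epsilon> by (simp add: field_simps flip: ennreal_mult)
    also have "\<dots> \<le> ennreal (C1 * 1)"
      using C N \<epsilon> by (intro ennreal_leI mult_left_mono) auto
    finally show ?thesis by (simp add: mult_left_mono)
  qed
  \<comment> \<open>A far interval is compared with the whole cell \<open>[j/N, (j+1)/N)\<close>, and the cells are disjoint.\<close>
  have I_far: "I j \<le> 4 * (\<integral>\<^sup>+ y. riesz_kernel \<tau> x y * indicator (cell j) y \<partial>lborel)" if "j \<notin> near" for j
  proof -
    define D where "D = \<bar>x - real_of_int j / N\<bar>"
    have D: "D > 2 / N" using that by (auto simp: near_def D_def)
    moreover have "0 < 1 / N" "2 / N = 2 * (1 / N)" using N by simp_all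
    ultimately have D0: "D > 0" "1 / N \<le> D / 2" by linarith+
    have "I j \<le> (\<integral>\<^sup>+ y. ennreal ((D / 2) powr (- \<tau>)) * ennreal (1 / (N * \<epsilon>)) * indicator (b j) y \<partial>lborel)"
      unfolding I_def
    proof (rule nn_integral_mono)
      fix y show "riesz_kernel \<tau> x y * (ennreal (1 / (N * \<epsilon>)) * indicator (b j) y)
        \<le> ennreal ((D / 2) powr (- \<tau>)) * ennreal (1 / (N * \<epsilon>)) * indicator (b j) y"
      proof (cases "y \<in> b j")
        case True
        then have "D / 2 \<le> \<bar>x - y\<bar>"
        proof -
          have "\<bar>y - real_of_int j / N\<bar> \<le> \<epsilon>" using True by (auto simp: b_def)
          then show ?thesis using D0 \<epsilon> abs_triangle_ineq[of "x - y" "y - real_of_int j / N"] by (simp add: D_def)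
        qed
        then show ?thesis
          using riesz_kernel_le_antimono[of "D / 2" x y \<tau>] D0 \<tau> True by (auto intro!: mult_right_mono)
      qed simp
    qed
    also have "\<dots> = ennreal ((D / 2) powr (- \<tau>)) * ennreal (1 / (N * \<epsilon>)) * ennreal \<epsilon>"
      by (simp add: nn_integral_cmult_indicator b_emeasure)
    also have "\<dots> = ennreal ((D / 2) powr (- \<tau>) * (1 / N))"
      using N \<epsilon> D0 by (simp flip: ennreal_mult)
    \<comment> \<open>Distances from \<open>x\<close> are at least \<open>D / 2\<close> on the
      interval and at most \<open>2 * D\<close> on the cell, so the kernels compare up to the factor
      \<open>4 powr \<tau> \<le> 4\<close>.\<close>
    also have "\<dots> \<le> ennreal (4 * ((2 * D) powr (- \<tau>) * (1 / N)))"
    proof (rule ennreal_leI)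
      have "(D / 2) powr (- \<tau>) = (4 powr \<tau>) * (2 * D) powr (- \<tau>)"
        using D0 powr_mult[of 4 "D / 2" "- \<tau>"] by (simp add: powr_minus)
      also have "\<dots> \<le> 4 powr 1 * (2 * D) powr (- \<tau>)"
        using \<tau> by (intro mult_right_mono powr_mono) auto
      finally have "(D / 2) powr (- \<tau>) * (1 / N) \<le> 4 * (2 * D) powr (- \<tau>) * (1 / N)"
        using N by (intro mult_right_mono) auto
      then show "(D / 2) powr (- \<tau>) * (1 / N) \<le> 4 * ((2 * D) powr (- \<tau>) * (1 / N))" by simp
    qed
    also have "\<dots> = 4 * (ennreal ((2 * D) powr (- \<tau>)) * ennreal (1 / N))"
      using N by (subst ennreal_mult) (auto simp flip: ennreal_mult)
    also have "ennreal (1 / N) = emeasure lborel (cell j)"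
      using N by (simp add: cell_def field_simps)
    also have "ennreal ((2 * D) powr (- \<tau>)) * emeasure lborel (cell j)
        = (\<integral>\<^sup>+ y. ennreal ((2 * D) powr (- \<tau>)) * indicator (cell j) y \<partial>lborel)"
      by (simp add: nn_integral_cmult_indicator)
    also have "\<dots> \<le> (\<integral>\<^sup>+ y. riesz_kernel \<tau> x y * indicator (cell j) y \<partial>lborel)"
    proof (rule nn_integral_mono)
      fix y show "ennreal ((2 * D) powr (- \<tau>)) * indicator (cell j) y \<le> riesz_kernel \<tau> x y * indicator (cell j) y"
      proof (cases "y \<in> cell j")
        case True
        then have "\<bar>y - real_of_int j / N\<bar> \<le> 1 / N" by (auto simp: cell_def add_divide_distrib)
        moreover have "\<bar>x - y\<bar> \<le> D + \<bar>y - real_of_int j / N\<bar>" unfolding D_def by linarith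
        ultimately have "\<bar>x - y\<bar> \<le> 2 * D" using D0 by linarith
        then show ?thesis using riesz_kernel_ge_antimono[of x y "2 * D" \<tau>] D0 \<tau> by (auto intro!: mult_right_mono)
      qed simp
    qed
    finally show ?thesis by (simp add: mult_left_mono)
  qed
  have cells: "(\<Sum>j\<in>J. indicator (cell j) y) \<le> (indicator {- M..M + 1} y :: ennreal)" for y
  proof -
    have "y \<in> cell j \<longleftrightarrow> \<lfloor>N * y\<rfloor> = j" for j
      using N by (auto simp: cell_def floor_eq_iff field_simps)
    then have "(\<Sum>j\<in>J. indicator (cell j) y) = (\<Sum>j\<in>J. if j = \<lfloor>N * y\<rfloor> then 1 else (0::ennreal))"
      by (intro sum.cong) (auto simp: indicator_def)
    also have "\<dots> = (if \<lfloor>N * y\<rfloor> \<in> J then 1 else 0)" using J by simp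
    also have "\<dots> \<le> indicator {- M..M + 1} y"
    proof (cases "\<lfloor>N * y\<rfloor> \<in> J")
      case True
      then have "- (M * N) \<le> N * y" "N * y \<le> M * N + 1" unfolding J_def by (auto simp: abs_le_iff) linarith+
      moreover have "M * N + 1 \<le> N * (M + 1)" using N by (simp add: algebra_simps)
      ultimately have "N * (- M) \<le> N * y" "N * y \<le> N * (M + 1)" by (auto simp: mult.commute)
      then have "y \<in> {- M..M + 1}" using N by (auto simp only: mult_le_cancel_left_pos atLeastAtMost_iff)
      then show ?thesis by simp
    qed simp
    finally show ?thesis .
  qed
  have near_card: "finite (J \<inter> near)" "real (card (J \<inter> near)) \<le> 5"
  proof -
    have "J \<inter> near \<subseteq> {\<lceil>N * x - 2\<rceil>..\<lfloor>N * x + 2\<rfloor>}"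
    proof
      fix j assume "j \<in> J \<inter> near"
      then have "\<bar>x - real_of_int j / N\<bar> * N \<le> 2" using N by (simp add: near_def pos_le_divide_eq)
      then have "\<bar>(x - real_of_int j / N) * N\<bar> \<le> 2" using N by (simp add: abs_mult)
      then have "\<bar>N * x - real_of_int j\<bar> \<le> 2" using N by (simp add: algebra_simps)
      then show "j \<in> {\<lceil>N * x - 2\<rceil>..\<lfloor>N * x + 2\<rfloor>}"
        unfolding atLeastAtMost_iff le_floor_iff ceiling_le_iff by linarith
    qed
    then have "card (J \<inter> near) \<le> card {\<lceil>N * x - 2\<rceil>..\<lfloor>N * x + 2\<rfloor>}" by (intro card_mono) auto
    also have "\<dots> \<le> 5" by simp linarith
    finally show "real (card (J \<inter> near)) \<le> 5" by simp
  qed (use J in auto)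
  have "(\<integral>\<^sup>+ y. riesz_kernel \<tau> x y * grid_density M N \<epsilon> y \<partial>lborel)
      \<le> (\<integral>\<^sup>+ y. (\<Sum>j\<in>J. riesz_kernel \<tau> x y * (ennreal (1 / (N * \<epsilon>)) * indicator (b j) y)) \<partial>lborel)"
  proof (rule nn_integral_mono)
    fix y
    have "indicator (grid M N \<epsilon>) y \<le> (\<Sum>j\<in>J. indicator (b j) y :: ennreal)"
    proof (cases "y \<in> grid M N \<epsilon>")
      case True
      then obtain j where "j \<in> J" "y \<in> b j" by (auto simp: grid_def J_def b_def)
      then show ?thesis using member_le_sum[of j J "\<lambda>j. indicator (b j) y :: ennreal"] J True by simp
    qed simp
    then show "riesz_kernel \<tau> x y * grid_density M N \<epsilon> y
      \<le> (\<Sum>j\<in>J. riesz_kernel \<tau> x y * (ennreal (1 / (N * \<epsilon>)) * indicator (b j) y))"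
      unfolding grid_density_def sum_distrib_left[symmetric] by (intro mult_left_mono) auto
  qed
  also have "\<dots> = (\<Sum>j\<in>J. I j)"
    unfolding I_def by (intro nn_integral_sum) measurable
  also have "\<dots> \<le> (\<Sum>j\<in>J. (if j \<in> near then ennreal C1 else 0)
      + 4 * (\<integral>\<^sup>+ y. riesz_kernel \<tau> x y * indicator (cell j) y \<partial>lborel))"
    using I_near I_far by (intro sum_mono) (auto simp: add_increasing2)
  also have "\<dots> = (\<Sum>j\<in>J. if j \<in> near then ennreal C1 else 0)
      + 4 * (\<integral>\<^sup>+ y. riesz_kernel \<tau> x y * (\<Sum>j\<in>J. indicator (cell j) y) \<partial>lborel)"
  proof -
    have "(\<integral>\<^sup>+ y. riesz_kernel \<tau> x y * (\<Sum>j\<in>J. indicator (cell j) y) \<partial>lborel)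
        = (\<Sum>j\<in>J. \<integral>\<^sup>+ y. riesz_kernel \<tau> x y * indicator (cell j) y \<partial>lborel)"
      unfolding sum_distrib_left by (rule nn_integral_sum) measurable
    then show ?thesis by (simp only: sum.distrib sum_distrib_left)
  qed
  also have "(\<Sum>j\<in>J. if j \<in> near then ennreal C1 else 0) = ennreal (real (card (J \<inter> near)) * C1)"
    using J C by (simp add: sum.If_cases ennreal_mult ennreal_of_nat_eq_real_of_nat)
  also have "\<dots> \<le> ennreal (5 * C1)"
    using near_card C by (intro ennreal_leI mult_right_mono)
  \<comment> \<open>The disjoint cells lie in \<open>{- M..M + 1}\<close>; the kernel is integrable
    near \<open>x\<close> and at most 1 from distance 1 on.\<close>
  also have "(\<integral>\<^sup>+ y. riesz_kernel \<tau> x y * (\<Sum>j\<in>J. indicator (cell j) y) \<partial>lborel)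
      \<le> (\<integral>\<^sup>+ y. riesz_kernel \<tau> x y * indicator {x - 1..x + 1} y + indicator {- M..M + 1} y \<partial>lborel)"
  proof (rule nn_integral_mono)
    fix y
    have "riesz_kernel \<tau> x y * (\<Sum>j\<in>J. indicator (cell j) y) \<le> riesz_kernel \<tau> x y * indicator {- M..M + 1} y"
      by (intro mult_left_mono cells) auto
    also have "\<dots> \<le> riesz_kernel \<tau> x y * indicator {x - 1..x + 1} y + indicator {- M..M + 1} y"
      using riesz_kernel_le_antimono[of 1 x y \<tau>] \<tau>
      by (cases "1 \<le> \<bar>x - y\<bar>") (auto simp: indicator_def add_increasing)
    finally show "riesz_kernel \<tau> x y * (\<Sum>j\<in>J. indicator (cell j) y)
      \<le> riesz_kernel \<tau> x y * indicator {x - 1..x + 1} y + indicator {- M..M + 1} y" .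
  qed
  also have "\<dots> = (\<integral>\<^sup>+ y. riesz_kernel \<tau> x y * indicator {x - 1..x + 1} y \<partial>lborel) + ennreal (2 * M + 1)"
    using M by (subst nn_integral_add) (auto simp: algebra_simps)
  also have "\<dots> \<le> ennreal (2 / (1 - \<tau>)) + ennreal (2 * M + 1)"
    using nn_integral_riesz_kernel_le[OF \<tau>, of 1 x] by (intro add_right_mono) auto
  also have "\<dots> = ennreal C2"
    using \<tau> M by (simp add: C2_def)
  also have "ennreal (5 * C1) + 4 * ennreal C2 = ennreal (5 * C1 + 4 * C2)"
    using C by (simp add: ennreal_mult)
  finally show "(\<integral>\<^sup>+ y. riesz_kernel \<tau> x y * grid_density M N \<epsilon> y \<partial>lborel) \<le> ennreal (5 * C1 + 4 * C2)"
    by (simp add: add_mono mult_left_mono)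
qed

text \<open>Splitting the exponent reduces bounds for potentials of product measures to dimension one. For
  the lattice below the split \<open>2 \<sigma>\<close> for the direction \<open>k\<close> and \<open>\<sigma>\<close> for the others, with
  \<open>(d + 1) \<sigma> = s\<close>, loses nothing.\<close>

lemma riesz_kernel_le_prod:
  fixes x y :: "real ^ 'd" and \<tau> :: "'d \<Rightarrow> real"
  assumes \<tau>: "\<And>i. \<tau> i > 0"
  shows "riesz_kernel (sum \<tau> UNIV) x y \<le> (\<Prod>i\<in>UNIV. riesz_kernel (\<tau> i) (x $ i) (y $ i))"
proof (cases "\<exists>i. x $ i = y $ i")
  case True
  then obtain i where i: "x $ i = y $ i" by blast
  \<comment> \<open>In \<open>ennreal\<close> an infinite factor makes the product infinite only
    when the remaining product is nonzero.\<close>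
  have "(\<Prod>j\<in>UNIV - {i}. riesz_kernel (\<tau> j) (x $ j) (y $ j)) \<noteq> 0"
    using \<tau> by (auto simp: riesz_kernel_def)
  then have "(\<Prod>i\<in>UNIV. riesz_kernel (\<tau> i) (x $ i) (y $ i)) = \<infinity>"
    using i \<tau>[of i] by (subst prod.remove[of _ i]) (auto simp: riesz_kernel_def ennreal_top_mult)
  then show ?thesis by simp
next
  case False
  then have xy: "x \<noteq> y" by auto
  have "norm (x - y) powr (- sum \<tau> UNIV) = (\<Prod>i\<in>UNIV. norm (x - y) powr (- \<tau> i))"
    using xy by (simp add: powr_sum sum_negf[symmetric])
  also have "\<dots> \<le> (\<Prod>i\<in>UNIV. \<bar>x $ i - y $ i\<bar> powr (- \<tau> i))"
    using False \<tau> component_le_norm_cart[of "x - y"]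
    by (intro prod_mono conjI powr_mono2') (auto intro: less_imp_le)
  finally show ?thesis
    using False xy by (auto simp: riesz_kernel_def prod_ennreal intro!: ennreal_leI)
qed

section \<open>Product integrals and thickened lattices\<close>

lemma nn_integral_lborel_prod_cart:
  fixes f :: "'d::finite \<Rightarrow> real \<Rightarrow> ennreal"
  assumes [measurable]: "\<And>i. f i \<in> borel_measurable borel"
  shows "(\<integral>\<^sup>+ x. (\<Prod>i\<in>UNIV. f i (x $ i)) \<partial>(lborel :: (real ^ 'd) measure)) = (\<Prod>i\<in>UNIV. \<integral>\<^sup>+ y. f i y \<partial>lborel)"
proof -
  have B: "(Basis :: (real ^ 'd) set) = range (\<lambda>i. axis i 1)"
    by (auto simp: Basis_vec_def)
  have inj: "inj (\<lambda>i::'d. axis i (1::real))"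
    by (simp add: inj_def axis_eq_axis)
  have "(\<integral>\<^sup>+ x. (\<Prod>b\<in>Basis. f (axis_index b) (x \<bullet> b)) \<partial>(lborel :: (real ^ 'd) measure))
      = (\<Prod>b\<in>(Basis :: (real ^ 'd) set). \<integral>\<^sup>+ y. f (axis_index b) y \<partial>lborel)"
    by (rule nn_integral_lborel_prod) auto
  then show ?thesis
    unfolding B prod.reindex[OF inj] by (simp add: inner_axis o_def)
qed

text \<open>Turns a count of triangles into a measure bound: the boxes at the three vertices have
  product mass at least \<open>c ^ 3\<close>, and the products for different triangles are
  disjoint.\<close>

lemma emeasure_triple_ge:
  fixes \<mu> :: "'a::second_countable_topology measure" and c :: ennreal
  assumes sets [measurable_cong]: "sets \<mu> = sets borel" and sf: "sigma_finite_measure \<mu>"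
    and T: "finite T"
    and F: "\<And>t. t \<in> T \<Longrightarrow> F1 t \<in> sets borel" "\<And>t. t \<in> T \<Longrightarrow> F2 t \<in> sets borel" "\<And>t. t \<in> T \<Longrightarrow> F3 t \<in> sets borel"
    and c: "\<And>t. t \<in> T \<Longrightarrow> c \<le> emeasure \<mu> (F1 t)" "\<And>t. t \<in> T \<Longrightarrow> c \<le> emeasure \<mu> (F2 t)"
      "\<And>t. t \<in> T \<Longrightarrow> c \<le> emeasure \<mu> (F3 t)"
    and disj: "disjoint_family_on (\<lambda>t. F1 t \<times> F2 t \<times> F3 t) T"
    and S: "S \<in> sets (\<mu> \<Otimes>\<^sub>M \<mu> \<Otimes>\<^sub>M \<mu>)" and sub: "\<And>t. t \<in> T \<Longrightarrow> F1 t \<times> F2 t \<times> F3 t \<subseteq> S"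
  shows "of_nat (card T) * c ^ 3 \<le> emeasure (\<mu> \<Otimes>\<^sub>M \<mu> \<Otimes>\<^sub>M \<mu>) S"
proof -
  interpret sigma_finite_measure \<mu> by (rule sf)
  interpret P: sigma_finite_measure "\<mu> \<Otimes>\<^sub>M \<mu>" by (rule sigma_finite_pair_measure[OF sf sf])
  have meas: "F1 t \<times> F2 t \<times> F3 t \<in> sets (\<mu> \<Otimes>\<^sub>M \<mu> \<Otimes>\<^sub>M \<mu>)" if "t \<in> T" for t
    using F[OF that] sets by (intro pair_measureI) auto
  have "of_nat (card T) * c ^ 3 = (\<Sum>t\<in>T. c * (c * c))" by (simp add: power3_eq_cube mult.assoc)
  also have "\<dots> \<le> (\<Sum>t\<in>T. emeasure \<mu> (F1 t) * (emeasure \<mu> (F2 t) * emeasure \<mu> (F3 t)))"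
    using c by (intro sum_mono mult_mono) auto
  also have "\<dots> = (\<Sum>t\<in>T. emeasure (\<mu> \<Otimes>\<^sub>M \<mu> \<Otimes>\<^sub>M \<mu>) (F1 t \<times> F2 t \<times> F3 t))"
    using F sets by (intro sum.cong refl) (simp add: P.emeasure_pair_measure_Times emeasure_pair_measure_Times)
  also have "\<dots> = emeasure (\<mu> \<Otimes>\<^sub>M \<mu> \<Otimes>\<^sub>M \<mu>) (\<Union>t\<in>T. F1 t \<times> F2 t \<times> F3 t)"
    using T meas disj by (intro sum_emeasure) auto
  also have "\<dots> \<le> emeasure (\<mu> \<Otimes>\<^sub>M \<mu> \<Otimes>\<^sub>M \<mu>) S"
    using sub S by (intro emeasure_mono) auto
  finally show ?thesis .
qed

text \<open>The reciprocal of the lattice step, that is, the number of lattice points per unit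
  length in direction \<open>i\<close>.\<close>

definition spacing :: "'d \<Rightarrow> real \<Rightarrow> 'd \<Rightarrow> real" where
  "spacing k L i = (if i = k then L\<^sup>2 else L)"

text \<open>The bound 20 leaves room for all triangles used below, whose vertices have height at
  most \<open>5 * K = 20 * L\<^sup>2\<close> in lattice steps.\<close>

definition lattice_density :: "'d::finite \<Rightarrow> real \<Rightarrow> real \<Rightarrow> real ^ 'd \<Rightarrow> ennreal" where
  "lattice_density k L \<epsilon> y = (\<Prod>i\<in>UNIV. grid_density 20 (spacing k L i) \<epsilon> (y $ i))"

definition lattice_box :: "'d::finite \<Rightarrow> real \<Rightarrow> real \<Rightarrow> ('d \<Rightarrow> int) \<Rightarrow> (real ^ 'd) set" where
  "lattice_box k L \<epsilon> p = {y. \<forall>i. y $ i \<in> {p i / spacing k L i..p i / spacing k L i + \<epsilon>}}"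

lemma spacing_ge_1: "L \<ge> 1 \<Longrightarrow> spacing k L i \<ge> 1"
  by (simp add: spacing_def)

lemma spacing_le: "L \<ge> 1 \<Longrightarrow> spacing k L i \<le> L\<^sup>2"
  by (simp add: spacing_def power2_eq_square)

lemma measurable_lattice_density [measurable]: "lattice_density k L \<epsilon> \<in> borel_measurable borel"
  unfolding lattice_density_def by measurable

lemma prod_spacing:
  fixes f :: "real \<Rightarrow> 'a::comm_monoid_mult" and k :: "'d::finite"
  shows "(\<Prod>i\<in>UNIV. f (spacing k L i)) = f (L\<^sup>2) * f L ^ (CARD('d) - 1)"
proof -
  have "(\<Prod>i\<in>UNIV. f (spacing k L i)) = f (L\<^sup>2) * (\<Prod>i\<in>UNIV - {k}. f L)"
    by (subst prod.remove[of _ k]) (auto simp: spacing_def intro!: prod.cong)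
  then show ?thesis by simp
qed

text \<open>The kernel is bounded by a product of one-dimensional kernels with exponents
  \<open>2 * \<sigma>\<close> and \<open>\<sigma>\<close>; the upper bound on \<open>s\<close> says
  that \<open>2 * \<sigma> < 1\<close>.\<close>

lemma lattice_potential_bound:
  fixes k :: "'d::finite"
  assumes s: "0 < s" "s < (real CARD('d) + 1) / 2"
  shows "\<exists>A::real. \<forall>L \<epsilon> x. L \<ge> 1 \<longrightarrow> 0 < \<epsilon> \<longrightarrow> \<epsilon> \<le> 1 / L\<^sup>2 \<longrightarrow>
    \<epsilon> powr (- (s / (real CARD('d) + 1))) \<le> L \<longrightarrow>
    (\<integral>\<^sup>+ y. riesz_kernel s x y * lattice_density k L \<epsilon> y \<partial>lborel) \<le> ennreal A"
proof -
  define \<sigma> where "\<sigma> = s / (real CARD('d) + 1)"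
  define \<tau> where "\<tau> i = (if i = k then 2 * \<sigma> else \<sigma>)" for i
  have \<sigma>: "0 < \<sigma>" "2 * \<sigma> < 1" using s by (simp_all add: \<sigma>_def field_simps)
  then have \<tau>: "0 < \<tau> i" "\<tau> i < 1" for i by (simp_all add: \<tau>_def)
  have "sum \<tau> UNIV = 2 * \<sigma> + (\<Sum>i\<in>UNIV - {k}. \<sigma>)"
    by (subst sum.remove[of _ k]) (auto simp: \<tau>_def intro!: sum.cong)
  also have "\<dots> = (real CARD('d) + 1) * \<sigma>"
    by (simp add: of_nat_diff algebra_simps)
  finally have sum_\<tau>: "sum \<tau> UNIV = s" by (simp add: \<sigma>_def)
  have "\<exists>A::real. \<forall>N \<epsilon> x. N \<ge> 1 \<longrightarrow> 0 < \<epsilon> \<longrightarrow> \<epsilon> \<le> 1 / N \<longrightarrow> \<epsilon> powr (- \<tau> i) \<le> N \<longrightarrow>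
    (\<integral>\<^sup>+ y. riesz_kernel (\<tau> i) x y * grid_density 20 N \<epsilon> y \<partial>lborel) \<le> ennreal A" for i
    using \<tau> by (intro grid_potential_bound) auto
  then obtain A where A: "\<And>i N \<epsilon> x. N \<ge> 1 \<Longrightarrow> 0 < \<epsilon> \<Longrightarrow> \<epsilon> \<le> 1 / N \<Longrightarrow> \<epsilon> powr (- \<tau> i) \<le> N \<Longrightarrow>
    (\<integral>\<^sup>+ y. riesz_kernel (\<tau> i) x y * grid_density 20 N \<epsilon> y \<partial>lborel) \<le> ennreal (A i)" by metis
  show ?thesis
  proof (intro exI allI impI)
    fix L \<epsilon> :: real and x :: "real ^ 'd"
    assume L: "L \<ge> 1" and \<epsilon>: "0 < \<epsilon>" "\<epsilon> \<le> 1 / L\<^sup>2" "\<epsilon> powr (- (s / (real CARD('d) + 1))) \<le> L"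
    have "(\<integral>\<^sup>+ y. riesz_kernel s x y * lattice_density k L \<epsilon> y \<partial>lborel)
        \<le> (\<integral>\<^sup>+ y. (\<Prod>i\<in>UNIV. riesz_kernel (\<tau> i) (x $ i) (y $ i) * grid_density 20 (spacing k L i) \<epsilon> (y $ i)) \<partial>lborel)"
      unfolding lattice_density_def prod.distrib
      using riesz_kernel_le_prod[of \<tau> x] \<tau>(1) sum_\<tau> by (intro nn_integral_mono mult_right_mono) auto
    also have "\<dots> = (\<Prod>i\<in>UNIV. \<integral>\<^sup>+ y. riesz_kernel (\<tau> i) (x $ i) y * grid_density 20 (spacing k L i) \<epsilon> y \<partial>lborel)"
      by (rule nn_integral_lborel_prod_cart) measurable
    also have "\<dots> \<le> (\<Prod>i\<in>UNIV. ennreal (A i))"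
    proof (intro prod_mono_ennreal A)
      fix i
      show "spacing k L i \<ge> 1" using L by (rule spacing_ge_1)
      then have "1 / L\<^sup>2 \<le> 1 / spacing k L i"
        using spacing_le[OF L, of k i] L by (intro divide_left_mono) auto
      then show "\<epsilon> \<le> 1 / spacing k L i" using \<epsilon> by linarith
      \<comment> \<open>The hypothesis on \<open>\<epsilon>\<close> is the one for the directions
        with step \<open>1 / L\<close>; its square is the one for direction
        \<open>k\<close>.\<close>
      have "\<epsilon> powr (- (2 * \<sigma>)) = (\<epsilon> powr (- \<sigma>))\<^sup>2"
        using powr_add[of \<epsilon> "- \<sigma>" "- \<sigma>"] by (simp add: power2_eq_square)
      also have "\<dots> \<le> L\<^sup>2" using \<epsilon> by (intro power_mono) (auto simp: \<sigma>_def)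
      finally show "\<epsilon> powr (- \<tau> i) \<le> spacing k L i"
        using \<epsilon> by (simp add: \<tau>_def spacing_def \<sigma>_def)
    qed (use \<epsilon> in auto)
    \<comment> \<open>Absolute values, because the constants \<open>A i\<close> are not known to be
      nonnegative.\<close>
    also have "\<dots> \<le> (\<Prod>i\<in>UNIV. ennreal \<bar>A i\<bar>)"
      by (intro prod_mono_ennreal ennreal_leI) auto
    also have "\<dots> = ennreal (\<Prod>i\<in>UNIV. \<bar>A i\<bar>)" by (simp add: prod_ennreal)
    finally show "(\<integral>\<^sup>+ y. riesz_kernel s x y * lattice_density k L \<epsilon> y \<partial>lborel) \<le> ennreal (\<Prod>i\<in>UNIV. \<bar>A i\<bar>)" .
  qed
qed

lemma lattice_density_support:
  fixes y :: "real ^ 'd"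
  assumes "L \<ge> 1" "\<epsilon> \<le> 1" "lattice_density k L \<epsilon> y \<noteq> 0"
  shows "norm y \<le> 21 * real CARD('d)"
proof -
  have "\<bar>y $ i\<bar> \<le> 21" for i
  proof -
    have "grid_density 20 (spacing k L i) \<epsilon> (y $ i) \<noteq> 0"
      using assms(3) by (auto simp: lattice_density_def)
    then have "y $ i \<in> grid 20 (spacing k L i) \<epsilon>"
      by (auto simp: grid_density_def indicator_def split: if_splits)
    then show ?thesis using grid_subset[OF spacing_ge_1[OF assms(1)] assms(2)] by fastforce
  qed
  then have "(\<Sum>i\<in>UNIV. \<bar>y $ i\<bar>) \<le> (\<Sum>i\<in>(UNIV :: 'd set). 21)" by (intro sum_mono)
  then show ?thesis using norm_le_l1_cart[of y] by simp
qed

lemma measurable_lattice_box [measurable]: "lattice_box k L \<epsilon> p \<in> sets borel"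
proof -
  have "lattice_box k L \<epsilon> p = cbox (\<chi> i. p i / spacing k L i) (\<chi> i. p i / spacing k L i + \<epsilon>)"
    by (auto simp: lattice_box_def mem_box_cart)
  then show ?thesis by simp
qed

lemma emeasure_lattice_box:
  fixes k :: "'d::finite"
  assumes L: "L \<ge> 1" and \<epsilon>: "0 < \<epsilon>" and p: "\<And>i. \<bar>real_of_int (p i)\<bar> \<le> 20 * spacing k L i"
  shows "emeasure (density lborel (lattice_density k L \<epsilon>)) (lattice_box k L \<epsilon> p)
    = ennreal (1 / (L\<^sup>2 * L ^ (CARD('d) - 1)))"
proof -
  define b where "b i = {p i / spacing k L i..p i / spacing k L i + \<epsilon>}" for i
  have [measurable]: "b i \<in> sets borel" for i by (simp add: b_def)
  have "emeasure (density lborel (lattice_density k L \<epsilon>)) (lattice_box k L \<epsilon> p)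
      = (\<integral>\<^sup>+ y. lattice_density k L \<epsilon> y * indicator (lattice_box k L \<epsilon> p) y \<partial>lborel)"
    by (intro emeasure_density) auto
  also have "\<dots> = (\<integral>\<^sup>+ y. (\<Prod>i\<in>UNIV. grid_density 20 (spacing k L i) \<epsilon> (y $ i) * indicator (b i) (y $ i)) \<partial>lborel)"
  proof (rule nn_integral_cong)
    fix y :: "real ^ 'd"
    have "indicator (lattice_box k L \<epsilon> p) y = (\<Prod>i\<in>UNIV. indicator (b i) (y $ i) :: ennreal)"
    proof (cases "y \<in> lattice_box k L \<epsilon> p")
      case False
      then obtain i where "y $ i \<notin> b i" by (auto simp: lattice_box_def b_def)
      then show ?thesis using False by (auto intro!: prod_zero[symmetric] exI[of _ i])
    qed (simp add: lattice_box_def b_def)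
    then show "lattice_density k L \<epsilon> y * indicator (lattice_box k L \<epsilon> p) y
      = (\<Prod>i\<in>UNIV. grid_density 20 (spacing k L i) \<epsilon> (y $ i) * indicator (b i) (y $ i))"
      by (simp add: lattice_density_def prod.distrib)
  qed
  also have "\<dots> = (\<Prod>i\<in>UNIV. \<integral>\<^sup>+ y. grid_density 20 (spacing k L i) \<epsilon> y * indicator (b i) y \<partial>lborel)"
    by (rule nn_integral_lborel_prod_cart) measurable
  also have "\<dots> = (\<Prod>i\<in>UNIV. ennreal (1 / spacing k L i))"
  proof (rule prod.cong[OF refl])
    fix i
    have N: "spacing k L i \<ge> 1" using L by (rule spacing_ge_1)
    have "b i \<subseteq> grid 20 (spacing k L i) \<epsilon>" using p[of i] by (auto simp: b_def grid_def)
    then have "(\<integral>\<^sup>+ y. grid_density 20 (spacing k L i) \<epsilon> y * indicator (b i) y \<partial>lborel)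
       = (\<integral>\<^sup>+ y. ennreal (1 / (spacing k L i * \<epsilon>)) * indicator (b i) y \<partial>lborel)"
      by (intro nn_integral_cong) (auto simp: grid_density_def indicator_def)
    also have "\<dots> = ennreal (1 / (spacing k L i * \<epsilon>)) * ennreal \<epsilon>"
      using \<epsilon> by (simp add: nn_integral_cmult_indicator) (simp add: b_def)
    also have "\<dots> = ennreal (1 / spacing k L i)"
      using N \<epsilon> by (simp flip: ennreal_mult)
    finally show "(\<integral>\<^sup>+ y. grid_density 20 (spacing k L i) \<epsilon> y * indicator (b i) y \<partial>lborel) = ennreal (1 / spacing k L i)" .
  qed
  also have "\<dots> = ennreal (\<Prod>i\<in>UNIV. 1 / spacing k L i)"
    using spacing_ge_1[OF L] by (intro prod_ennreal) (auto intro!: order_trans[OF zero_le_one])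
  also have "(\<Prod>i\<in>UNIV. 1 / spacing k L i) = 1 / (L\<^sup>2 * L ^ (CARD('d) - 1))"
    by (subst prod_spacing[where f = "\<lambda>x. 1 / x"]) (simp add: power_one_over)
  finally show ?thesis .
qed

text \<open>The boxes are closed, so their side must be strictly below the smallest lattice step
  \<open>1 / L\<^sup>2\<close>.\<close>

lemma lattice_box_disjoint:
  assumes L: "L \<ge> 1" and \<epsilon>: "\<epsilon> < 1 / L\<^sup>2" and "p \<noteq> p'"
  shows "lattice_box k L \<epsilon> p \<inter> lattice_box k L \<epsilon> p' = {}"
proof -
  have *: "lattice_box k L \<epsilon> p \<inter> lattice_box k L \<epsilon> p' = {}" if "p i < p' i" for p p' i
  proof -
    have N: "spacing k L i \<ge> 1" using L by (rule spacing_ge_1)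
    have "1 / L\<^sup>2 \<le> 1 / spacing k L i"
      using spacing_le[OF L, of k i] N L by (intro divide_left_mono) auto
    then have "real_of_int (p i) / spacing k L i + \<epsilon> < (real_of_int (p i) + 1) / spacing k L i"
      using \<epsilon> by (simp add: add_divide_distrib)
    also have "\<dots> \<le> real_of_int (p' i) / spacing k L i"
      using that N by (intro divide_right_mono) linarith+
    finally have lt: "real_of_int (p i) / spacing k L i + \<epsilon> < real_of_int (p' i) / spacing k L i" .
    show ?thesis
    proof (rule equals0I)
      fix y assume "y \<in> lattice_box k L \<epsilon> p \<inter> lattice_box k L \<epsilon> p'"
      then have "y $ i \<le> real_of_int (p i) / spacing k L i + \<epsilon>" "real_of_int (p' i) / spacing k L i \<le> y $ i"
        by (auto simp: lattice_box_def)
      then show False using lt by linarith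
    qed
  qed
  obtain i where "p i \<noteq> p' i" using assms by blast
  then show ?thesis using *[of p i p'] *[of p' i p] by (cases "p i < p' i") auto
qed

lemma lattice_box_diff:
  fixes x y :: "real ^ 'd"
  assumes "x \<in> lattice_box k L \<epsilon> p" "y \<in> lattice_box k L \<epsilon> p'"
  shows "norm ((x - y) - (\<chi> i. real_of_int (p i - p' i) / spacing k L i)) \<le> real CARD('d) * \<epsilon>"
proof -
  have "norm ((x - y) - (\<chi> i. real_of_int (p i - p' i) / spacing k L i))
      \<le> (\<Sum>i\<in>UNIV. \<bar>((x - y) - (\<chi> i. real_of_int (p i - p' i) / spacing k L i)) $ i\<bar>)"
    by (rule norm_le_l1_cart)
  also have "\<dots> \<le> (\<Sum>i\<in>(UNIV :: 'd set). \<epsilon>)"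
  proof (rule sum_mono)
    fix i
    have "x $ i \<in> {p i / spacing k L i..p i / spacing k L i + \<epsilon>}" "y $ i \<in> {p' i / spacing k L i..p' i / spacing k L i + \<epsilon>}"
      using assms by (auto simp: lattice_box_def)
    then show "\<bar>((x - y) - (\<chi> i. real_of_int (p i - p' i) / spacing k L i)) $ i\<bar> \<le> \<epsilon>"
      by (simp add: diff_divide_distrib abs_le_iff)
  qed
  finally show ?thesis by simp
qed

section \<open>Unit equilateral triangles in the lattice\<close>

definition unit_triples :: "'a::euclidean_space set \<Rightarrow> real \<Rightarrow> ('a \<times> 'a \<times> 'a) set" where
  "unit_triples B \<epsilon> = {(x1, x2, x3).
     1 - \<epsilon> \<le> body_norm B (x1 - x2) \<and> body_norm B (x1 - x2) \<le> 1 + \<epsilon> \<and>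
     1 - \<epsilon> \<le> body_norm B (x1 - x3) \<and> body_norm B (x1 - x3) \<le> 1 + \<epsilon> \<and>
     1 - \<epsilon> \<le> body_norm B (x2 - x3) \<and> body_norm B (x2 - x3) \<le> 1 + \<epsilon>}"

lemma measurable_body_norm:
  assumes "symmetric_convex_body B"
  shows "body_norm B \<in> borel_measurable borel"
proof -
  obtain C where C: "C > 0" "\<And>x y. \<bar>body_norm B x - body_norm B y\<bar> \<le> C * norm (x - y)"
    using body_norm_diff_le[OF assms] by metis
  then have "C-lipschitz_on UNIV (body_norm B)"
    by (auto intro!: lipschitz_onI simp: dist_norm)
  then show ?thesis
    by (intro borel_measurable_continuous_onI lipschitz_on_continuous_on)
qed

lemma unit_triples_measurable:
  assumes B: "symmetric_convex_body B" and \<mu>: "sets \<mu> = sets borel"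
  shows "unit_triples B \<epsilon> \<in> sets (\<mu> \<Otimes>\<^sub>M \<mu> \<Otimes>\<^sub>M \<mu>)"
proof -
  note [measurable] = measurable_body_norm[OF B]
  have "unit_triples B \<epsilon> = {x \<in> space (borel \<Otimes>\<^sub>M borel \<Otimes>\<^sub>M borel).
     1 - \<epsilon> \<le> body_norm B (fst x - fst (snd x)) \<and> body_norm B (fst x - fst (snd x)) \<le> 1 + \<epsilon> \<and>
     1 - \<epsilon> \<le> body_norm B (fst x - snd (snd x)) \<and> body_norm B (fst x - snd (snd x)) \<le> 1 + \<epsilon> \<and>
     1 - \<epsilon> \<le> body_norm B (fst (snd x) - snd (snd x)) \<and> body_norm B (fst (snd x) - snd (snd x)) \<le> 1 + \<epsilon>}"
    by (auto simp: unit_triples_def space_pair_measure)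
  also have "\<dots> \<in> sets (borel \<Otimes>\<^sub>M borel \<Otimes>\<^sub>M borel)" by measurable
  also have "sets (borel \<Otimes>\<^sub>M borel \<Otimes>\<^sub>M borel) = sets (\<mu> \<Otimes>\<^sub>M \<mu> \<Otimes>\<^sub>M \<mu>)"
    by (intro sets_pair_measure_cong \<mu>[symmetric])
  finally show ?thesis .
qed

text \<open>A horizontal vector is encoded as a function on all coordinates that is 0 at
  \<open>k\<close>. Entries in the narrow range keep inner products at least
  \<open>16 * m * n\<^sup>2\<close> and squared lengths at most \<open>25 * m * n\<^sup>2\<close>,
  where \<open>m\<close> is the number of horizontal directions. This ratio keeps the resulting
  points on the paraboloid cap.\<close>

definition int_cube :: "'d \<Rightarrow> nat \<Rightarrow> ('d \<Rightarrow> int) set" where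
  "int_cube k n = (\<Pi>\<^sub>E i\<in>UNIV. if i = k then {0} else {4 * int n..<5 * int n})"

lemma mem_int_cube: "a \<in> int_cube k n \<longleftrightarrow> a k = 0 \<and> (\<forall>i. i \<noteq> k \<longrightarrow> 4 * int n \<le> a i \<and> a i < 5 * int n)"
  by (auto simp: int_cube_def PiE_UNIV_domain Pi_iff split: if_splits)

lemma card_int_cube: "card (int_cube k n :: ('d::finite \<Rightarrow> int) set) = n ^ (CARD('d) - 1)"
proof -
  have "card (int_cube k n) = (\<Prod>i\<in>UNIV. if i = k then 1 else n)"
    unfolding int_cube_def by (subst card_PiE) (auto intro!: prod.cong)
  also have "\<dots> = 1 * (\<Prod>i\<in>UNIV - {k}. n)"
    by (subst prod.remove[of _ k]) (auto intro!: prod.cong)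
  finally show ?thesis by simp
qed

text \<open>Pigeonhole: \<open>n ^ (2 * m)\<close> pairs share at most
  \<open>10 * m * n\<^sup>2\<close> integer values of the inner product.\<close>

lemma popular_inner_product:
  fixes k :: "'d::finite"
  defines "m \<equiv> CARD('d) - 1"
  assumes m: "m \<ge> 1" and n: "n \<ge> 1"
  shows "\<exists>K::int. 16 * int m * (int n)\<^sup>2 \<le> K \<and> K \<le> 25 * int m * (int n)\<^sup>2 \<and>
    n ^ (2 * m) \<le> 10 * m * n\<^sup>2 *
      card {(a, b). a \<in> int_cube k n \<and> b \<in> int_cube k n \<and> (\<Sum>i\<in>UNIV - {k}. a i * b i) = K}"
proof -
  define f :: "('d \<Rightarrow> int) \<times> ('d \<Rightarrow> int) \<Rightarrow> int" where "f = (\<lambda>(a, b). \<Sum>i\<in>UNIV - {k}. a i * b i)"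
  define V where "V = int_cube k n"
  have fin: "finite V" unfolding V_def int_cube_def by (intro finite_PiE) auto
  have card: "card V = n ^ m" unfolding V_def m_def by (rule card_int_cube)
  define R where "R = {16 * int m * (int n)\<^sup>2..25 * int m * (int n)\<^sup>2}"
  have "f (a, b) \<in> R" if "a \<in> V" "b \<in> V" for a b
  proof -
    have ab: "a i \<in> {4 * int n..<5 * int n}" "b i \<in> {4 * int n..<5 * int n}" if "i \<noteq> k" for i
      using \<open>a \<in> V\<close> \<open>b \<in> V\<close> \<open>i \<noteq> k\<close> by (auto simp: V_def mem_int_cube)
    have 1: "16 * (int n)\<^sup>2 \<le> a i * b i" "a i * b i \<le> 25 * (int n)\<^sup>2" if "i \<noteq> k" for i
      using ab[OF that] mult_mono[of "4 * int n" "a i" "4 * int n" "b i"] mult_mono[of "a i" "5 * int n" "b i" "5 * int n"]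
      by (auto simp: power2_eq_square)
    have "(\<Sum>i\<in>UNIV - {k}. 16 * (int n)\<^sup>2) \<le> f (a, b)" "f (a, b) \<le> (\<Sum>i\<in>UNIV - {k}. 25 * (int n)\<^sup>2)"
      unfolding f_def prod.case by (intro sum_mono 1; simp)+
    moreover have "(\<Sum>i\<in>UNIV - {k}. x) = int m * x" for x by (simp add: m_def)
    ultimately show ?thesis unfolding R_def atLeastAtMost_iff by (simp only: mult_ac)
  qed
  then have f: "f \<in> V \<times> V \<rightarrow> R" by auto
  have R: "R \<noteq> {}" "finite R" unfolding R_def by auto
  have cardR: "card R \<le> 10 * m * n\<^sup>2"
  proof -
    \<comment> \<open>The 1 counts the second endpoint and is absorbed by
      \<open>m * n\<^sup>2\<close>, which turns 9 into 10.\<close>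
    have "card R = 9 * m * n\<^sup>2 + 1" unfolding R_def
      by (simp add: nat_eq_iff)
    moreover have "m * n\<^sup>2 \<ge> 1" using m n by simp
    ultimately show ?thesis by simp
  qed
  obtain K where K: "K \<in> R" "card (f -` {K} \<inter> V \<times> V) * card R \<ge> card (V \<times> V)"
    using pigeonhole_card[OF f _ R(2,1)] fin by auto
  have "f -` {K} \<inter> V \<times> V = {(a, b). a \<in> int_cube k n \<and> b \<in> int_cube k n \<and> (\<Sum>i\<in>UNIV - {k}. a i * b i) = K}"
    by (auto simp: f_def V_def)
  moreover have "card (V \<times> V) = n ^ (2 * m)" by (simp add: card_cartesian_product card power_mult power2_eq_square flip: power_add mult_2)
  ultimately have "n ^ (2 * m) \<le> card R * card {(a, b). a \<in> int_cube k n \<and> b \<in> int_cube k n \<and> (\<Sum>i\<in>UNIV - {k}. a i * b i) = K}"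
    using K(2) by (simp add: mult.commute)
  also have "\<dots> \<le> 10 * m * n\<^sup>2 * card {(a, b). a \<in> int_cube k n \<and> b \<in> int_cube k n \<and> (\<Sum>i\<in>UNIV - {k}. a i * b i) = K}"
    using cardR by (intro mult_right_mono) auto
  finally show ?thesis using K(1) by (auto simp: R_def)
qed

text \<open>The sequence \<open>e\<close> tends to 0, so every right neighbourhood of 0 contains
  points at which \<open>f\<close> is arbitrarily large.\<close>

lemma Limsup_at_right_0_eq_top:
  fixes f :: "real \<Rightarrow> ennreal" and e :: "nat \<Rightarrow> real"
  assumes e: "\<And>j. 0 < e j" "\<And>j. e j < 1 / (real j + 1)" and f: "\<And>j. of_nat j \<le> f (e j)"
  shows "Limsup (at_right 0) f = \<infinity>"
proof -
  have "(SUP x\<in>{x. P x}. f x) = \<infinity>" if P: "eventually P (at_right 0)" for P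
  proof -
    obtain b where b: "b > 0" "\<And>y. 0 < y \<Longrightarrow> y < b \<Longrightarrow> P y"
      using P by (auto simp: eventually_at_right_field)
    have "of_nat i \<le> (SUP x\<in>{x. P x}. f x)" for i :: nat
    proof -
      obtain j0 where j0: "inverse (real (Suc j0)) < b" using reals_Archimedean[OF b(1)] by blast
      define j where "j = max i j0"
      have "1 / (real j + 1) \<le> inverse (real (Suc j0))"
        unfolding inverse_eq_divide by (intro divide_left_mono) (auto simp: j_def)
      then have "P (e j)" using e[of j] j0 by (intro b(2)) auto
      then have "f (e j) \<le> (SUP x\<in>{x. P x}. f x)" by (intro SUP_upper) auto
      moreover have "(of_nat i :: ennreal) \<le> of_nat j" by (simp add: j_def)
      ultimately show ?thesis using f[of j] by (meson order_trans)
    qed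
    then have "(SUP i. of_nat i :: ennreal) \<le> (SUP x\<in>{x. P x}. f x)" by (intro SUP_least)
    then show ?thesis by (simp add: ennreal_SUP_of_nat_eq_top top_unique)
  qed
  then have "Limsup (at_right 0) f = (INF P\<in>{P. eventually P (at_right (0::real))}. \<infinity>)"
    unfolding Limsup_def by (intro INF_cong) auto
  then show ?thesis by (auto simp: INF_constant intro: exI[of _ "\<lambda>_. True"])
qed

text \<open>The counting rests on one geometric fact about the body: its unit sphere contains the
  paraboloid cap at height at least 1. The number of horizontal directions is
  \<open>m\<close>.\<close>

locale paraboloid_body =
  fixes B :: "(real ^ 'd::finite) set" and k :: 'd and m :: nat
  assumes body: "symmetric_convex_body B"
    and unit: "\<And>x. x $ k \<ge> 1 \<Longrightarrow> (\<Sum>i\<in>UNIV - {k}. (x $ i)\<^sup>2) + x $ k = 8 \<Longrightarrow> body_norm B x = 1"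
    and dim: "CARD('d) = Suc m" and m: "m \<ge> 1"
begin

section \<open>Lattice points on the paraboloid and their triangles\<close>

definition sq :: "('d \<Rightarrow> int) \<Rightarrow> int" where "sq z = (\<Sum>i\<in>UNIV - {k}. (z i)\<^sup>2)"

text \<open>If \<open>4 L\<^sup>2 = K\<close>, then the lattice vector \<open>lift K z\<close> is the point \<open>(z / L, 8 - \<bar>z / L\<bar>\<^sup>2)\<close> of the
  paraboloid, and by \<open>lift_diff\<close> the sum of two such points is a third one once \<open>\<langle>a, b\<rangle> = K\<close>.\<close>

definition lift :: "int \<Rightarrow> ('d \<Rightarrow> int) \<Rightarrow> 'd \<Rightarrow> int" where
  "lift K z i = (if i = k then 2 * K - sq z else z i)"

text \<open>As \<open>4 * L\<^sup>2 = K\<close>, the hypothesis on \<open>z\<close> says exactly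
  that the height \<open>8 - sq z / L\<^sup>2\<close> is at least 1.\<close>

lemma body_norm_lift:
  assumes L: "L > 0" "4 * L\<^sup>2 = real_of_int K" and z: "4 * sq z \<le> 7 * K"
  shows "body_norm B (\<chi> i. real_of_int (lift K z i) / spacing k L i) = 1"
proof (rule unit)
  have "7 * real_of_int K \<ge> 4 * real_of_int (sq z)" using z by linarith
  then show "(\<chi> i. real_of_int (lift K z i) / spacing k L i) $ k \<ge> 1"
    using L by (simp add: lift_def spacing_def)
  have "(\<Sum>i\<in>UNIV - {k}. ((\<chi> i. real_of_int (lift K z i) / spacing k L i) $ i)\<^sup>2) = real_of_int (sq z) / L\<^sup>2"
    by (simp add: lift_def spacing_def sq_def power_divide flip: sum_divide_distrib)
  moreover have "real_of_int (sq z) / L\<^sup>2 + (2 * real_of_int K - real_of_int (sq z)) / L\<^sup>2 = 8"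
    using L by (simp add: field_simps)
  ultimately show "(\<Sum>i\<in>UNIV - {k}. ((\<chi> i. real_of_int (lift K z i) / spacing k L i) $ i)\<^sup>2)
      + (\<chi> i. real_of_int (lift K z i) / spacing k L i) $ k = 8"
    by (simp add: lift_def spacing_def)
qed

text \<open>In coordinate \<open>k\<close> this is polarisation:
  \<open>4 K - |a|^2 - |b|^2 = 2 K - |a - b|^2\<close> when the inner product is
  \<open>K\<close>.\<close>

lemma lift_diff:
  assumes "(\<Sum>i\<in>UNIV - {k}. a i * b i) = K"
  shows "lift K a i + lift K (\<lambda>i. - b i) i = lift K (\<lambda>i. a i - b i) i"
proof -
  have "sq (\<lambda>i. a i - b i) = sq a + sq b - 2 * K"
    by (simp add: sq_def power2_diff sum.distrib sum_subtractf mult.assoc flip: assms sum_distrib_left)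
  then show ?thesis by (simp add: lift_def sq_def)
qed

lemma sq_le:
  assumes "\<And>i. i \<noteq> k \<Longrightarrow> \<bar>z i\<bar> \<le> c"
  shows "sq z \<le> int m * c\<^sup>2"
proof -
  have "(z i)\<^sup>2 \<le> c\<^sup>2" if "i \<noteq> k" for i
    using assms[OF that] by (metis abs_ge_zero power2_abs power_mono)
  then have "sq z \<le> (\<Sum>i\<in>UNIV - {k}. c\<^sup>2)" unfolding sq_def by (intro sum_mono) auto
  then show ?thesis by (simp add: dim)
qed

text \<open>A triangle is given by a translation \<open>q\<close> and a pair \<open>(a, b)\<close>
  with inner product \<open>K\<close>; there are \<open>n ^ (m + 2)\<close> translations and at
  least \<open>n ^ (2 * m - 2) / (10 * m)\<close> pairs. The bound is stated for every measure
  dominating a multiple of the lattice density, so that it applies to a sum over several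
  scales.\<close>

lemma exists_unit_triples:
  assumes n: "n \<ge> 1" and C: "\<And>x y. \<bar>body_norm B x - body_norm B y\<bar> \<le> C * norm (x - y)" "C > 0"
  obtains L where "L \<ge> real n" "L \<le> 3 * real m * real n"
    "\<And>\<epsilon> \<mu> c. 0 < \<epsilon> \<Longrightarrow> \<epsilon> < 1 / L\<^sup>2 \<Longrightarrow> sets \<mu> = sets borel \<Longrightarrow> sigma_finite_measure \<mu> \<Longrightarrow>
      (\<And>X. X \<in> sets borel \<Longrightarrow> c * emeasure (density lborel (lattice_density k L \<epsilon>)) X \<le> emeasure \<mu> X) \<Longrightarrow>
      ennreal (real n ^ (3 * m) / (10 * real m)) * (c * ennreal (1 / (L\<^sup>2 * L ^ m))) ^ 3
        \<le> emeasure (\<mu> \<Otimes>\<^sub>M \<mu> \<Otimes>\<^sub>M \<mu>) (unit_triples B (C * real CARD('d) * \<epsilon>))"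
proof -
  have m_eq: "CARD('d) - 1 = m" using dim by simp
  define Ps where "Ps K = {(a, b). a \<in> int_cube k n \<and> b \<in> int_cube k n \<and> (\<Sum>i\<in>UNIV - {k}. a i * b i) = K}" for K
  obtain K :: int where K: "16 * int m * (int n)\<^sup>2 \<le> K" "K \<le> 25 * int m * (int n)\<^sup>2"
    and cardPs: "n ^ (2 * m) \<le> 10 * m * n\<^sup>2 * card (Ps K)"
    using popular_inner_product[OF _ n, of k] m unfolding m_eq Ps_def by blast
  define P where "P = Ps K"
  \<comment> \<open>The ranges are adapted to the two lattice steps, so each translation moves every
    coordinate by less than 1.\<close>
  define Qs :: "('d \<Rightarrow> int) set" where "Qs = (\<Pi>\<^sub>E i\<in>UNIV. if i = k then {0..<(int n)\<^sup>2} else {0..<int n})"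
  have K': "16 * real m * (real n)\<^sup>2 \<le> real_of_int K" "real_of_int K \<le> 25 * real m * (real n)\<^sup>2"
  proof -
    have "real_of_int (16 * int m * (int n)\<^sup>2) \<le> real_of_int K" using K(1) by (rule of_int_le_iff[THEN iffD2])
    then show "16 * real m * (real n)\<^sup>2 \<le> real_of_int K" by simp
    have "real_of_int K \<le> real_of_int (25 * int m * (int n)\<^sup>2)" using K(2) by (rule of_int_le_iff[THEN iffD2])
    then show "real_of_int K \<le> 25 * real m * (real n)\<^sup>2" by simp
  qed
  \<comment> \<open>\<open>L\<close> may be irrational; it is \<open>4 * L\<^sup>2\<close>, the
    popular inner product, that has to be an integer.\<close>
  define L where "L = sqrt (real_of_int K) / 2"
  have "1 * (real n)\<^sup>2 \<le> real m * (real n)\<^sup>2"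
    using m by (intro mult_right_mono) auto
  then have n2: "16 * (real n)\<^sup>2 \<le> real_of_int K" using K' by linarith
  then have L2: "4 * L\<^sup>2 = real_of_int K"
    unfolding L_def using order_trans[OF _ n2, of 0] by (simp add: power_divide)
  have Ln: "2 * real n \<le> L"
    unfolding L_def using real_le_rsqrt[of "4 * real n" "real_of_int K"] n2 by (simp add: power_mult_distrib)
  have Lu: "L \<le> 3 * real m * real n"
  proof -
    have "real m * (real n)\<^sup>2 \<le> (real m)\<^sup>2 * (real n)\<^sup>2"
      using m by (intro mult_right_mono) (auto simp: power2_eq_square)
    moreover have "0 \<le> (real m)\<^sup>2 * (real n)\<^sup>2" by simp
    ultimately have "real_of_int K \<le> 36 * ((real m)\<^sup>2 * (real n)\<^sup>2)"
      using K'(2) by linarith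
    then have "real_of_int K \<le> (6 * (real m * real n))\<^sup>2" by (simp add: power_mult_distrib)
    then have "sqrt (real_of_int K) \<le> 6 * (real m * real n)" by (intro real_le_lsqrt) auto
    then show ?thesis by (simp add: L_def)
  qed
  have L1: "L \<ge> 1" using Ln n by linarith
  have cube: "\<bar>a i\<bar> \<le> 5 * int n" "4 * int n \<le> a i" if "a \<in> int_cube k n" "i \<noteq> k" for a i
    using that by (auto simp: mem_int_cube abs_le_iff intro: less_imp_le)
  \<comment> \<open>The numerical content is \<open>4 * 25 \<le> 7 * 16\<close> and
    \<open>25 \<le> 2 * 16\<close>.\<close>
  have sq7: "4 * sq z \<le> 7 * K" "0 \<le> 2 * K - sq z" if "\<And>i. i \<noteq> k \<Longrightarrow> \<bar>z i\<bar> \<le> 5 * int n" for z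
    using sq_le[of z "5 * int n", OF that] K by (auto simp: power_mult_distrib)
  have sq0: "sq z \<ge> 0" for z unfolding sq_def by (intro sum_nonneg) auto
  define p1 p2 p3 :: "('d \<Rightarrow> int) \<times> ('d \<Rightarrow> int) \<times> ('d \<Rightarrow> int) \<Rightarrow> 'd \<Rightarrow> int" where
    "p1 = (\<lambda>(q, a, b) i. q i + lift K (\<lambda>i. - b i) i + lift K a i)" and
    "p2 = (\<lambda>(q, a, b) i. q i + lift K (\<lambda>i. - b i) i)" and
    "p3 = (\<lambda>(q, a, b). q)"
  define T where "T = Qs \<times> P"
  have unit12: "body_norm B (\<chi> i. real_of_int (p1 t i - p2 t i) / spacing k L i) = 1"
    and unit23: "body_norm B (\<chi> i. real_of_int (p2 t i - p3 t i) / spacing k L i) = 1"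
    and unit13: "body_norm B (\<chi> i. real_of_int (p1 t i - p3 t i) / spacing k L i) = 1"
    and bound: "\<bar>real_of_int (p1 t i)\<bar> \<le> 20 * spacing k L i" "\<bar>real_of_int (p2 t i)\<bar> \<le> 20 * spacing k L i"
      "\<bar>real_of_int (p3 t i)\<bar> \<le> 20 * spacing k L i"
    if "t \<in> T" for t i
  proof -
    obtain q a b where t: "t = (q, a, b)" "q \<in> Qs" "a \<in> int_cube k n" "b \<in> int_cube k n"
      "(\<Sum>i\<in>UNIV - {k}. a i * b i) = K"
      using \<open>t \<in> T\<close> by (auto simp: T_def P_def Ps_def)
    \<comment> \<open>Entries from a common narrow range have small differences, so the third side
      of the triangle also ends on the cap.\<close>
    have ab: "\<bar>a i - b i\<bar> \<le> 5 * int n" if "i \<noteq> k" for i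
      using cube[OF t(3) that] cube[OF t(4) that] by linarith
    have eqs: "p1 t i - p2 t i = lift K a i" "p2 t i - p3 t i = lift K (\<lambda>i. - b i) i"
      "p1 t i - p3 t i = lift K (\<lambda>i. a i - b i) i" for i
      using lift_diff[OF t(5), of i] by (simp_all add: p1_def p2_def p3_def t(1))
    have "L > 0" using L1 by simp
    then show "body_norm B (\<chi> i. real_of_int (p1 t i - p2 t i) / spacing k L i) = 1"
      "body_norm B (\<chi> i. real_of_int (p2 t i - p3 t i) / spacing k L i) = 1"
      "body_norm B (\<chi> i. real_of_int (p1 t i - p3 t i) / spacing k L i) = 1"
      unfolding eqs using L2 cube(1)[OF t(3)] cube(1)[OF t(4)] ab by (auto intro!: body_norm_lift sq7)
    have "\<bar>p1 t i\<bar> \<le> 11 * int n \<and> \<bar>p2 t i\<bar> \<le> 11 * int n \<and> \<bar>p3 t i\<bar> \<le> 11 * int n" if "i \<noteq> k"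
    proof -
      have "q i \<in> {0..<int n}" using t(2) that
        by (auto simp: Qs_def PiE_UNIV_domain Pi_iff dest: spec[of _ i])
      then show ?thesis
        using cube[OF t(3) that] cube[OF t(4) that] that by (auto simp: p1_def p2_def p3_def t(1) lift_def)
    qed
    moreover have "\<bar>p1 t k\<bar> \<le> 5 * K \<and> \<bar>p2 t k\<bar> \<le> 5 * K \<and> \<bar>p3 t k\<bar> \<le> 5 * K"
    proof -
      have "q k \<in> {0..<(int n)\<^sup>2}" using t(2) by (auto simp: Qs_def PiE_UNIV_domain Pi_iff split: if_splits)
      moreover have "(int n)\<^sup>2 \<le> K"
      proof -
        have "(real n)\<^sup>2 \<le> real_of_int K" using n2 zero_le_power2[of "real n"] by linarith
        then show ?thesis by (simp flip: of_int_le_iff[where 'a = real])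
      qed
      moreover have "0 \<le> 2 * K - sq a" "0 \<le> 2 * K - sq (\<lambda>i. - b i)"
        using sq7(2)[of a] sq7(2)[of "\<lambda>i. - b i"] cube(1)[OF t(3)] cube(1)[OF t(4)] by auto
      ultimately show ?thesis
        using sq0[of a] sq0[of "\<lambda>i. - b i"] by (simp add: p1_def p2_def p3_def t(1) lift_def)
    qed
    moreover have "\<bar>real_of_int x\<bar> \<le> 20 * spacing k L i"
      if "i \<noteq> k \<Longrightarrow> \<bar>x\<bar> \<le> 11 * int n" "i = k \<Longrightarrow> \<bar>x\<bar> \<le> 5 * K" for x
    proof (cases "i = k")
      case True
      have "real_of_int \<bar>x\<bar> \<le> real_of_int (5 * K)" using that(2)[OF True] by (simp only: of_int_le_iff)
      then show ?thesis using True L2 by (simp add: spacing_def)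
    next
      case False
      have "real_of_int \<bar>x\<bar> \<le> real_of_int (11 * int n)" using that(1)[OF False] by (simp only: of_int_le_iff)
      then show ?thesis using False Ln by (simp add: spacing_def)
    qed
    ultimately show "\<bar>real_of_int (p1 t i)\<bar> \<le> 20 * spacing k L i" "\<bar>real_of_int (p2 t i)\<bar> \<le> 20 * spacing k L i"
      "\<bar>real_of_int (p3 t i)\<bar> \<le> 20 * spacing k L i"
      by blast+
  qed
  \<comment> \<open>\<open>p3\<close> gives \<open>q\<close>, then \<open>p2\<close> gives
    \<open>b\<close> and \<open>p1\<close> gives \<open>a\<close>: they are read off from the
    horizontal coordinates, which \<open>lift\<close> leaves unchanged.\<close>
  have inj: "t = t'" if tt: "t \<in> T" "t' \<in> T" and p: "p1 t = p1 t'" "p2 t = p2 t'" "p3 t = p3 t'" for t t'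
  proof -
    obtain q a b where t: "t = (q, a, b)" "a \<in> int_cube k n" "b \<in> int_cube k n"
      using tt by (auto simp: T_def P_def Ps_def)
    obtain q' a' b' where t': "t' = (q', a', b')" "a' \<in> int_cube k n" "b' \<in> int_cube k n"
      using tt by (auto simp: T_def P_def Ps_def)
    have z: "c k = 0" if "c \<in> int_cube k n" for c
      using that by (simp add: mem_int_cube)
    have q: "q = q'" using p(3) by (simp add: p3_def t(1) t'(1))
    have b: "lift K (\<lambda>i. - b i) i = lift K (\<lambda>i. - b' i) i" for i
      using fun_cong[OF p(2), of i] unfolding p2_def t(1) t'(1) q by simp
    have a: "lift K a i = lift K a' i" for i
      using fun_cong[OF p(1), of i] b[of i] unfolding p1_def t(1) t'(1) q by simp
    have "a = a'"
    proof
      fix i show "a i = a' i" using a[of i] z[OF t(2)] z[OF t'(2)] by (cases "i = k") (simp_all add: lift_def)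
    qed
    moreover have "b = b'"
    proof
      fix i show "b i = b' i" using b[of i] z[OF t(3)] z[OF t'(3)] by (cases "i = k") (simp_all add: lift_def)
    qed
    ultimately show ?thesis unfolding t(1) t'(1) q by simp
  qed
  have finP: "finite P"
  proof (rule finite_subset)
    show "P \<subseteq> int_cube k n \<times> int_cube k n" by (auto simp: P_def Ps_def)
    show "finite (int_cube k n \<times> int_cube k n)"
      unfolding int_cube_def by (intro finite_cartesian_product finite_PiE) auto
  qed
  have finT: "finite T" unfolding T_def Qs_def using finP by (intro finite_cartesian_product finite_PiE) auto
  have "card Qs = (\<Prod>i\<in>UNIV. if i = k then n\<^sup>2 else n)"
    unfolding Qs_def by (subst card_PiE) (auto intro!: prod.cong simp: nat_power_eq)
  also have "\<dots> = n\<^sup>2 * (\<Prod>i\<in>UNIV - {k}. n)"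
    by (subst prod.remove[of _ k]) (auto intro!: prod.cong)
  also have "\<dots> = n\<^sup>2 * n ^ m" by (simp add: dim)
  finally have "card T = n\<^sup>2 * n ^ m * card P" by (simp add: T_def card_cartesian_product)
  \<comment> \<open>The \<open>n\<^sup>2\<close> vertical translations make up for the loss in the
    pigeonhole.\<close>
  then have "10 * m * card T = n ^ m * (10 * m * n\<^sup>2 * card P)" by simp
  also have "\<dots> \<ge> n ^ m * n ^ (2 * m)" using cardPs by (simp only: P_def mult_le_mono2)
  finally have "n ^ (m + 2 * m) \<le> 10 * m * card T" by (simp only: power_add)
  then have cardT: "n ^ (3 * m) \<le> 10 * m * card T" by simp
  show ?thesis
  proof (rule that[of L])
    show "real n \<le> L" using Ln by simp
    show "L \<le> 3 * real m * real n" by (rule Lu)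
    fix \<epsilon> :: real and \<mu> :: "(real ^ 'd) measure" and c :: ennreal
    assume \<epsilon>: "0 < \<epsilon>" "\<epsilon> < 1 / L\<^sup>2" and \<mu>: "sets \<mu> = sets borel" "sigma_finite_measure \<mu>"
      and le: "\<And>X. X \<in> sets borel \<Longrightarrow> c * emeasure (density lborel (lattice_density k L \<epsilon>)) X \<le> emeasure \<mu> X"
    define Q where "Q p = lattice_box k L \<epsilon> p" for p
    define w where "w = c * ennreal (1 / (L\<^sup>2 * L ^ m))"
    have w: "w \<le> emeasure \<mu> (Q p)" if "\<And>i. \<bar>real_of_int (p i)\<bar> \<le> 20 * spacing k L i" for p
      using le[of "Q p"] emeasure_lattice_box[OF L1 \<epsilon>(1) that]
      by (simp add: w_def Q_def measurable_lattice_box dim)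
    have close: "1 - C * real CARD('d) * \<epsilon> \<le> body_norm B (x - y) \<and> body_norm B (x - y) \<le> 1 + C * real CARD('d) * \<epsilon>"
      if "x \<in> Q p" "y \<in> Q p'" "body_norm B (\<chi> i. real_of_int (p i - p' i) / spacing k L i) = 1" for x y p p'
    proof -
      have "\<bar>body_norm B (x - y) - 1\<bar> \<le> C * norm ((x - y) - (\<chi> i. real_of_int (p i - p' i) / spacing k L i))"
        using C(1)[of "x - y" "\<chi> i. real_of_int (p i - p' i) / spacing k L i"] that(3) by simp
      also have "\<dots> \<le> C * (real CARD('d) * \<epsilon>)"
        using lattice_box_diff[of x k L \<epsilon> p y p'] that C(2) by (intro mult_left_mono) (auto simp: Q_def)
      finally show ?thesis by (simp add: abs_le_iff mult.assoc)
    qed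
    have "ennreal (real n ^ (3 * m) / (10 * real m)) \<le> of_nat (card T)"
    proof -
      have "real (n ^ (3 * m)) \<le> real (10 * m * card T)" using cardT by (rule of_nat_mono)
      then have "real n ^ (3 * m) / (10 * real m) \<le> real (card T)"
        using m by (simp add: pos_divide_le_eq mult_ac)
      then show ?thesis by (simp add: ennreal_leI flip: ennreal_of_nat_eq_real_of_nat)
    qed
    then have "ennreal (real n ^ (3 * m) / (10 * real m)) * w ^ 3 \<le> of_nat (card T) * w ^ 3"
      by (intro mult_right_mono) auto
    also have "\<dots> \<le> emeasure (\<mu> \<Otimes>\<^sub>M \<mu> \<Otimes>\<^sub>M \<mu>) (unit_triples B (C * real CARD('d) * \<epsilon>))"
    proof (rule emeasure_triple_ge[where ?F1.0 = "\<lambda>t. Q (p1 t)" and ?F2.0 = "\<lambda>t. Q (p2 t)" and ?F3.0 = "\<lambda>t. Q (p3 t)"])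
      show "disjoint_family_on (\<lambda>t. Q (p1 t) \<times> Q (p2 t) \<times> Q (p3 t)) T"
        unfolding disjoint_family_on_def
      proof (intro ballI impI)
        fix t t' assume t: "t \<in> T" "t' \<in> T" "t \<noteq> t'"
        then have "p1 t \<noteq> p1 t' \<or> p2 t \<noteq> p2 t' \<or> p3 t \<noteq> p3 t'" using inj by blast
        then have "Q (p1 t) \<inter> Q (p1 t') = {} \<or> Q (p2 t) \<inter> Q (p2 t') = {} \<or> Q (p3 t) \<inter> Q (p3 t') = {}"
          unfolding Q_def using lattice_box_disjoint[OF L1 \<epsilon>(2)] by blast
        then show "Q (p1 t) \<times> Q (p2 t) \<times> Q (p3 t) \<inter> Q (p1 t') \<times> Q (p2 t') \<times> Q (p3 t') = {}"
          by (simp add: Times_Int_Times)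
      qed
      show "Q (p1 t) \<times> Q (p2 t) \<times> Q (p3 t) \<subseteq> unit_triples B (C * real CARD('d) * \<epsilon>)" if "t \<in> T" for t
        using close unit12[OF that] unit23[OF that] unit13[OF that]
        unfolding unit_triples_def by blast
      show "w \<le> emeasure \<mu> (Q (p1 t))" "w \<le> emeasure \<mu> (Q (p2 t))" "w \<le> emeasure \<mu> (Q (p3 t))" if "t \<in> T" for t
        by (intro w bound that)+
    qed (use \<mu> finT in \<open>auto intro!: unit_triples_measurable body simp: Q_def measurable_lattice_box\<close>)
    finally show "ennreal (real n ^ (3 * m) / (10 * real m)) * (c * ennreal (1 / (L\<^sup>2 * L ^ m))) ^ 3
        \<le> emeasure (\<mu> \<Otimes>\<^sub>M \<mu> \<Otimes>\<^sub>M \<mu>) (unit_triples B (C * real CARD('d) * \<epsilon>))"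
      by (simp add: w_def)
  qed
qed


text \<open>The last clause ranges over all measures dominating \<open>c\<close> times the density,
  at the cost of \<open>c ^ 3\<close>, so that it passes to weighted sums.\<close>

definition concentrated :: "real \<Rightarrow> real \<Rightarrow> real \<Rightarrow> real \<Rightarrow> (real ^ 'd \<Rightarrow> ennreal) \<Rightarrow> bool" where
  "concentrated s A K \<epsilon> h \<longleftrightarrow> h \<in> borel_measurable borel \<and>
    (\<forall>x. (\<integral>\<^sup>+ y. riesz_kernel s x y * h y \<partial>lborel) \<le> ennreal A) \<and>
    (\<forall>y. h y \<noteq> 0 \<longrightarrow> norm y \<le> 21 * real CARD('d)) \<and>
    (\<forall>\<mu> c. sets \<mu> = sets borel \<longrightarrow> sigma_finite_measure \<mu> \<longrightarrow>
      (\<forall>X\<in>sets borel. c * emeasure (density lborel h) X \<le> emeasure \<mu> X) \<longrightarrow>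
      c ^ 3 * ennreal K \<le> ennreal (1 / \<epsilon> ^ 3) * emeasure (\<mu> \<Otimes>\<^sub>M \<mu> \<Otimes>\<^sub>M \<mu>) (unit_triples B \<epsilon>))"

text \<open>The order of quantifiers matters: \<open>A\<close> serves all \<open>K\<close> and
  \<open>\<delta>\<close>. With boxes of side \<open>L powr (- \<kappa>)\<close> the normalised
  triple measure grows at least like \<open>L powr (3 * \<kappa> - 6)\<close>, while the potential
  stays bounded.\<close>

lemma exists_concentrated:
  assumes s: "0 < s" "s < (real CARD('d) + 1) / 2"
  shows "\<exists>A. \<forall>K \<delta>. \<delta> > 0 \<longrightarrow> (\<exists>\<epsilon> h. 0 < \<epsilon> \<and> \<epsilon> < \<delta> \<and> concentrated s A K \<epsilon> h)"
proof -
  obtain C where C: "C > 0" "\<And>x y. \<bar>body_norm B x - body_norm B y\<bar> \<le> C * norm (x - y)"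
    using body_norm_diff_le[OF body] by metis
  obtain A where A: "\<And>L \<epsilon> x. L \<ge> 1 \<Longrightarrow> 0 < \<epsilon> \<Longrightarrow> \<epsilon> \<le> 1 / L\<^sup>2 \<Longrightarrow>
    \<epsilon> powr (- (s / (real CARD('d) + 1))) \<le> L \<Longrightarrow>
    (\<integral>\<^sup>+ y. riesz_kernel s x y * lattice_density k L \<epsilon> y \<partial>lborel) \<le> ennreal A"
    using lattice_potential_bound[OF s, of k] by metis
  define \<sigma> where "\<sigma> = s / (real CARD('d) + 1)"
  have \<sigma>: "0 < \<sigma>" "\<sigma> < 1 / 2" using s by (simp_all add: \<sigma>_def field_simps)
  \<comment> \<open>The midpoint of 2 and \<open>1 / \<sigma>\<close>: \<open>\<kappa> > 2\<close>
    makes the triple measure grow, and \<open>\<kappa> * \<sigma> < 1\<close> keeps the potential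
    bounded.\<close>
  define \<kappa> where "\<kappa> = (2 + 1 / \<sigma>) / 2"
  have \<kappa>: "\<kappa> > 2" "\<kappa> * \<sigma> < 1" using \<sigma> by (simp_all add: \<kappa>_def field_simps)
  define D where "D = C * real CARD('d)"
  have D: "D > 0" using C by (simp add: D_def)
  \<comment> \<open>This collects the losses: \<open>n \<ge> L / (3 * m)\<close>, the pigeonhole
    factor, and the ratio \<open>D\<close> between the distance tolerance and the side of the
    boxes.\<close>
  define c0 where "c0 = 1 / ((3 * real m) ^ (3 * m) * (10 * real m) * D ^ 3)"
  have c0: "c0 > 0" using D m by (simp add: c0_def)
  show ?thesis
  proof (rule exI[of _ A], intro allI impI)
    fix K \<delta> :: real assume \<delta>: "\<delta> > 0"
    have "((\<lambda>n. D * real n powr (- \<kappa>)) \<longlongrightarrow> D * 0) sequentially"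
      using \<kappa> by (intro tendsto_mult tendsto_const tendsto_neg_powr filterlim_real_sequentially) auto
    then have 1: "\<forall>\<^sub>F n in sequentially. D * real n powr (- \<kappa>) < \<delta>"
      using \<delta> by (intro order_tendstoD) auto
    have "((\<lambda>n. K * real n powr (- (3 * \<kappa> - 6))) \<longlongrightarrow> K * 0) sequentially"
      using \<kappa> by (intro tendsto_mult tendsto_const tendsto_neg_powr filterlim_real_sequentially) auto
    then have 2: "\<forall>\<^sub>F n in sequentially. K * real n powr (- (3 * \<kappa> - 6)) < c0"
      using c0 by (intro order_tendstoD) auto
    have 3: "\<forall>\<^sub>F n in sequentially. 2 \<le> n" by (rule eventually_ge_at_top)
    obtain n where n: "D * real n powr (- \<kappa>) < \<delta>" "K * real n powr (- (3 * \<kappa> - 6)) < c0" "2 \<le> n"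
      using eventually_happens[OF eventually_conj[OF 1 eventually_conj[OF 2 3]]] by auto
    obtain L where L: "L \<ge> real n" "L \<le> 3 * real m * real n" and triples:
      "\<And>\<epsilon> \<mu> c. 0 < \<epsilon> \<Longrightarrow> \<epsilon> < 1 / L\<^sup>2 \<Longrightarrow> sets \<mu> = sets borel \<Longrightarrow> sigma_finite_measure \<mu> \<Longrightarrow>
      (\<And>X. X \<in> sets borel \<Longrightarrow> c * emeasure (density lborel (lattice_density k L \<epsilon>)) X \<le> emeasure \<mu> X) \<Longrightarrow>
      ennreal (real n ^ (3 * m) / (10 * real m)) * (c * ennreal (1 / (L\<^sup>2 * L ^ m))) ^ 3
        \<le> emeasure (\<mu> \<Otimes>\<^sub>M \<mu> \<Otimes>\<^sub>M \<mu>) (unit_triples B (C * real CARD('d) * \<epsilon>))"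
      using exists_unit_triples[of n C] C n(3) by auto
    have L1: "L > 1" using L(1) n(3) by linarith
    define \<eta> where "\<eta> = L powr (- \<kappa>)"
    have \<eta>0: "\<eta> > 0" using L1 by (simp add: \<eta>_def)
    have "\<eta> < L powr (- 2)" unfolding \<eta>_def using L1 \<kappa> by (intro powr_less_mono) auto
    also have "\<dots> = 1 / L\<^sup>2" using L1 by (simp add: powr_minus divide_inverse)
    finally have \<eta>L: "\<eta> < 1 / L\<^sup>2" .
    have "1 / L\<^sup>2 \<le> 1" using L1 by simp
    then have \<eta>1: "\<eta> \<le> 1" using \<eta>L by linarith
    have "\<eta> powr (- \<sigma>) = L powr (\<kappa> * \<sigma>)" by (simp add: \<eta>_def powr_powr)
    also have "\<dots> \<le> L powr 1" using L1 \<kappa> by (intro powr_mono) auto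
    finally have \<eta>\<sigma>: "\<eta> powr (- \<sigma>) \<le> L" using L1 by simp
    have "\<eta> \<le> real n powr (- \<kappa>)"
      unfolding \<eta>_def using L(1) n(3) \<kappa> by (intro powr_mono2') auto
    then have \<eta>\<delta>: "D * \<eta> < \<delta>" using n(1) D mult_left_mono[of \<eta> "real n powr (- \<kappa>)" D] by linarith
    have count: "K \<le> 1 / (D * \<eta>) ^ 3 * (real n ^ (3 * m) / (10 * real m) * (1 / (L\<^sup>2 * L ^ m)) ^ 3)"
    proof -
      have "K \<le> c0 * real n powr (3 * \<kappa> - 6)"
      proof -
        have "K = K * real n powr (- (3 * \<kappa> - 6)) * real n powr (3 * \<kappa> - 6)"
          using n(3) by (simp add: mult.assoc flip: powr_add)
        also have "\<dots> \<le> c0 * real n powr (3 * \<kappa> - 6)"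
          using n(2) by (intro mult_right_mono) auto
        finally show ?thesis .
      qed
      also have "\<dots> \<le> c0 * L powr (3 * \<kappa> - 6)"
        using L(1) c0 \<kappa> by (intro mult_left_mono powr_mono2) auto
      also have "\<dots> = 1 / D ^ 3 * (L powr (3 * \<kappa>) * ((L / (3 * real m)) ^ (3 * m) / (10 * real m) * (1 / (L ^ 6 * L ^ (3 * m)))))"
      proof -
        have "L powr (3 * \<kappa> - 6) = L powr (3 * \<kappa>) / L ^ 6" using L1 by (simp add: powr_diff)
        then show ?thesis using L1 D m by (simp add: c0_def field_simps)
      qed
      also have "\<dots> \<le> 1 / D ^ 3 * (L powr (3 * \<kappa>) * (real n ^ (3 * m) / (10 * real m) * (1 / (L ^ 6 * L ^ (3 * m)))))"
        using L L1 D m by (intro mult_left_mono mult_right_mono divide_right_mono power_mono) (auto simp: field_simps)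
      also have "L powr (3 * \<kappa>) = 1 / \<eta> ^ 3"
        using L1 by (simp add: \<eta>_def powr_power powr_minus field_simps)
      also have "L ^ 6 * L ^ (3 * m) = (L\<^sup>2 * L ^ m) ^ 3"
        by (simp add: power_mult_distrib mult.commute flip: power_mult)
      also have "1 / D ^ 3 * (1 / \<eta> ^ 3 * (Y * (1 / W ^ 3))) = 1 / (D * \<eta>) ^ 3 * (Y * (1 / W) ^ 3)" for Y W :: real
        by (simp add: power_mult_distrib power_one_over)
      finally show ?thesis .
    qed
    show "\<exists>\<epsilon> h. 0 < \<epsilon> \<and> \<epsilon> < \<delta> \<and> concentrated s A K \<epsilon> h"
      unfolding concentrated_def
    proof (intro exI[of _ "D * \<eta>"] exI[of _ "lattice_density k L \<eta>"] conjI allI impI)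
      show "0 < D * \<eta>" using D \<eta>0 by simp
      show "D * \<eta> < \<delta>" by (rule \<eta>\<delta>)
      show "lattice_density k L \<eta> \<in> borel_measurable borel" by (rule measurable_lattice_density)
      show "(\<integral>\<^sup>+ y. riesz_kernel s x y * lattice_density k L \<eta> y \<partial>lborel) \<le> ennreal A" for x
        using L1 \<eta>0 \<eta>L \<eta>\<sigma> by (intro A) (auto simp: \<sigma>_def)
      show "norm y \<le> 21 * real CARD('d)" if "lattice_density k L \<eta> y \<noteq> 0" for y
        using lattice_density_support[OF _ \<eta>1 that] L1 by simp
      fix \<mu> :: "(real ^ 'd) measure" and c :: ennreal
      assume \<mu>: "sets \<mu> = sets borel" "sigma_finite_measure \<mu>"
        and le: "\<forall>X\<in>sets borel. c * emeasure (density lborel (lattice_density k L \<eta>)) X \<le> emeasure \<mu> X"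
      define w where "w = ennreal (1 / (D * \<eta>) ^ 3)"
      have "c ^ 3 * ennreal K \<le> c ^ 3 * ennreal (1 / (D * \<eta>) ^ 3 * (real n ^ (3 * m) / (10 * real m) * (1 / (L\<^sup>2 * L ^ m)) ^ 3))"
        using count by (intro mult_left_mono ennreal_leI) auto
      also have "\<dots> = w * (ennreal (real n ^ (3 * m) / (10 * real m)) * (c * ennreal (1 / (L\<^sup>2 * L ^ m))) ^ 3)"
      proof -
        have prod3: "ennreal (x * (y * z ^ 3)) = ennreal x * (ennreal y * ennreal z ^ 3)" if "0 \<le> x" "0 \<le> y" "0 \<le> z" for x y z :: real
          using that by (simp add: ennreal_mult ennreal_power)
        have "ennreal (1 / (D * \<eta>) ^ 3 * (real n ^ (3 * m) / (10 * real m) * (1 / (L\<^sup>2 * L ^ m)) ^ 3))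
          = w * (ennreal (real n ^ (3 * m) / (10 * real m)) * ennreal (1 / (L\<^sup>2 * L ^ m)) ^ 3)"
          unfolding w_def by (rule prod3) (use L1 D \<eta>0 in auto)
        then show ?thesis by (simp add: power_mult_distrib mult_ac)
      qed
      also have "\<dots> \<le> w * emeasure (\<mu> \<Otimes>\<^sub>M \<mu> \<Otimes>\<^sub>M \<mu>) (unit_triples B (D * \<eta>))"
        unfolding D_def using \<eta>0 \<eta>L \<mu> le by (intro mult_left_mono triples) auto
      finally show "c ^ 3 * ennreal K \<le> ennreal (1 / (D * \<eta>) ^ 3) * emeasure (\<mu> \<Otimes>\<^sub>M \<mu> \<Otimes>\<^sub>M \<mu>) (unit_triples B (D * \<eta>))"
        by (simp add: w_def)
    qed
  qed
qed

text \<open>The densities of a sequence of scales are added with weights of sum 1, which preserves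
  the potential bound; each summand alone makes the triple measure large at its own scale.\<close>

lemma exists_concentrated_measure:
  assumes s: "s < (real CARD('d) + 1) / 2"
  shows "\<exists>\<mu> :: (real ^ 'd) measure. sets \<mu> = sets borel \<and> sigma_finite_measure \<mu> \<and> energy s \<mu> < \<infinity> \<and>
    Limsup (at_right 0) (\<lambda>\<epsilon>::real. ennreal (1 / \<epsilon> ^ 3) * emeasure (\<mu> \<Otimes>\<^sub>M \<mu> \<Otimes>\<^sub>M \<mu>) (unit_triples B \<epsilon>)) = \<infinity>"
proof -
  \<comment> \<open>A positive exponent still below the threshold, as the dimension is at least 2;
    bounds for \<open>s\<close> follow on the bounded support.\<close>
  define s' where "s' = max s 1"
  have s': "s \<le> s'" "0 < s'" "0 \<le> s'" "s' < (real CARD('d) + 1) / 2" using s m by (auto simp: s'_def dim)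
  define R where "R = 21 * real CARD('d)"
  obtain A where A: "\<And>K \<delta>. \<delta> > 0 \<Longrightarrow> \<exists>\<epsilon> h. 0 < \<epsilon> \<and> \<epsilon> < \<delta> \<and> concentrated s' A K \<epsilon> h"
    using exists_concentrated[OF s'(2,4)] by blast
  \<comment> \<open>The factor \<open>8 ^ Suc j\<close> compensates the cube of the weight
    \<open>(1/2) ^ Suc j\<close>, leaving \<open>j\<close>.\<close>
  have "\<exists>\<epsilon> h. 0 < \<epsilon> \<and> \<epsilon> < 1 / (real j + 1) \<and> concentrated s' A (8 ^ Suc j * real j) \<epsilon> h" for j
    by (rule A) simp
  then obtain e h where e: "\<And>j. 0 < e j" "\<And>j. e j < 1 / (real j + 1)"
    and conc: "\<And>j. concentrated s' A (8 ^ Suc j * real j) (e j) (h j)"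
    by metis
  have h [measurable]: "h j \<in> borel_measurable borel" for j
    using conc[of j] by (simp add: concentrated_def)
  have pot: "(\<integral>\<^sup>+ y. riesz_kernel s' x y * h j y \<partial>lborel) \<le> ennreal A" for j x
    using conc[of j] by (simp add: concentrated_def)
  have supp: "norm y \<le> R" if "h j y \<noteq> 0" for j y
    using conc[of j] that by (simp add: concentrated_def R_def)
  have triples: "c ^ 3 * ennreal (8 ^ Suc j * real j)
      \<le> ennreal (1 / e j ^ 3) * emeasure (\<mu> \<Otimes>\<^sub>M \<mu> \<Otimes>\<^sub>M \<mu>) (unit_triples B (e j))"
    if "sets \<mu> = sets borel" "sigma_finite_measure \<mu>"
      "\<And>X. X \<in> sets borel \<Longrightarrow> c * emeasure (density lborel (h j)) X \<le> emeasure \<mu> X" for j \<mu> c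
    using conc[of j] that unfolding concentrated_def by blast
  define f where "f y = (\<Sum>j. (1/2) ^ Suc j * h j y)" for y
  have f [measurable]: "f \<in> borel_measurable borel" unfolding f_def by measurable
  define \<mu> where "\<mu> = density lborel f"
  have sets: "sets \<mu> = sets borel" by (simp add: \<mu>_def)
  have f_supp: "norm y \<le> R" if "f y \<noteq> 0" for y
  proof (rule ccontr)
    assume "\<not> norm y \<le> R"
    then have "h j y = 0" for j using supp by blast
    then show False using that by (simp add: f_def)
  qed
  have f_pot: "(\<integral>\<^sup>+ y. riesz_kernel s' x y * f y \<partial>lborel) \<le> ennreal A" for x
  proof -
    have "(\<integral>\<^sup>+ y. riesz_kernel s' x y * f y \<partial>lborel)
        = (\<integral>\<^sup>+ y. (\<Sum>j. (1/2) ^ Suc j * (riesz_kernel s' x y * h j y)) \<partial>lborel)"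
      unfolding f_def ennreal_suminf_cmult[symmetric] by (simp only: mult.left_commute)
    also have "\<dots> = (\<Sum>j. (1/2) ^ Suc j * (\<integral>\<^sup>+ y. riesz_kernel s' x y * h j y \<partial>lborel))"
      by (simp add: nn_integral_suminf nn_integral_cmult del: power_Suc)
    also have "\<dots> \<le> (\<Sum>j. (1/2) ^ Suc j * ennreal A)"
      using pot by (intro suminf_le mult_left_mono) auto
    also have "\<dots> = ennreal A"
    proof -
      have "(\<Sum>j. (1/2 :: ennreal) ^ Suc j) = (\<Sum>j. ennreal ((1/2) ^ Suc j))"
        by (simp add: divide_ennreal ennreal_power[symmetric] del: power_Suc flip: ennreal_1 ennreal_numeral)
      also have "\<dots> = 1"
        by (subst suminf_ennreal_eq[OF zero_le_power power_half_series]) auto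
      finally show ?thesis unfolding ennreal_suminf_multc by simp
    qed
    finally show ?thesis .
  qed
  define D where "D = 2 * R + 1"
  have D: "D \<ge> 1" by (simp add: D_def R_def)
  have pot': "(\<integral>\<^sup>+ y. riesz_kernel t x y * f y \<partial>lborel) \<le> ennreal (D powr (s' - t)) * ennreal A"
    if "t \<le> s'" "norm x \<le> R" for t x
  proof -
    have "(\<integral>\<^sup>+ y. riesz_kernel t x y * f y \<partial>lborel)
        \<le> (\<integral>\<^sup>+ y. ennreal (D powr (s' - t)) * (riesz_kernel s' x y * f y) \<partial>lborel)"
    proof (rule nn_integral_mono)
      fix y
      show "riesz_kernel t x y * f y \<le> ennreal (D powr (s' - t)) * (riesz_kernel s' x y * f y)"
      proof (cases "f y = 0")
        case False
        then have "norm (x - y) \<le> D"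
          using f_supp[OF False] that norm_triangle_ineq4[of x y] by (simp add: D_def)
        then have "riesz_kernel t x y \<le> ennreal (D powr (s' - t)) * riesz_kernel s' x y"
          using that s' D by (intro riesz_kernel_le_riesz_kernel) auto
        then show ?thesis unfolding mult.assoc[symmetric] by (intro mult_right_mono) auto
      qed simp
    qed
    also have "\<dots> = ennreal (D powr (s' - t)) * (\<integral>\<^sup>+ y. riesz_kernel s' x y * f y \<partial>lborel)"
      by (intro nn_integral_cmult) measurable
    finally show ?thesis using f_pot[of x] by (meson mult_left_mono order_trans zero_le)
  qed
  \<comment> \<open>The kernel of exponent 0 is 1 also on the diagonal, so the total mass is a
    potential.\<close>
  have "emeasure \<mu> (space \<mu>) = (\<integral>\<^sup>+ y. riesz_kernel 0 0 y * f y \<partial>lborel)"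
    unfolding \<mu>_def by (subst emeasure_density) (auto intro!: nn_integral_cong simp: riesz_kernel_def)
  also have "\<dots> \<le> ennreal (D powr (s' - 0)) * ennreal A"
    using s' by (intro pot') (auto simp: R_def)
  also have "\<dots> < \<infinity>" by (simp add: ennreal_mult_less_top)
  finally have fin: "emeasure \<mu> (space \<mu>) < \<infinity>" .
  then interpret finite_measure \<mu> by (intro finite_measureI) simp
  have sf: "sigma_finite_measure \<mu>" ..
  have "energy s \<mu> \<le> (\<integral>\<^sup>+ x. ennreal (D powr (s' - s)) * ennreal A \<partial>\<mu>)"
    unfolding energy_def
  proof (rule nn_integral_mono_AE)
    have "AE x in \<mu>. norm x \<le> R"
      unfolding \<mu>_def by (subst AE_density) (auto intro!: AE_I2 f_supp simp: less_imp_neq)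
    then show "AE x in \<mu>. (\<integral>\<^sup>+ y. riesz_kernel s x y \<partial>\<mu>) \<le> ennreal (D powr (s' - s)) * ennreal A"
    proof eventually_elim
      case (elim x)
      have "(\<integral>\<^sup>+ y. riesz_kernel s x y \<partial>\<mu>) = (\<integral>\<^sup>+ y. riesz_kernel s x y * f y \<partial>lborel)"
        unfolding \<mu>_def by (subst nn_integral_density) (auto simp: mult.commute)
      also have "\<dots> \<le> ennreal (D powr (s' - s)) * ennreal A"
        using s' elim by (intro pot') auto
      finally show ?case .
    qed
  qed
  also have "\<dots> < \<infinity>"
    using fin by (simp add: ennreal_mult_less_top)
  finally have energy: "energy s \<mu> < \<infinity>" .
  have "Limsup (at_right 0) (\<lambda>\<epsilon>::real. ennreal (1 / \<epsilon> ^ 3) * emeasure (\<mu> \<Otimes>\<^sub>M \<mu> \<Otimes>\<^sub>M \<mu>) (unit_triples B \<epsilon>)) = \<infinity>"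
  proof (rule Limsup_at_right_0_eq_top[of e])
    fix j
    have "((1/2 :: ennreal) ^ Suc j) ^ 3 * ennreal (8 ^ Suc j * real j) = of_nat j"
    proof -
      define q :: real where "q = (1/2) ^ Suc j"
      have half: "(1/2 :: ennreal) = ennreal (1/2)" by (subst divide_ennreal[symmetric]) auto
      have "((1/2 :: ennreal) ^ Suc j) ^ 3 = ennreal (q ^ 3)"
        unfolding half q_def by (subst ennreal_power, simp, subst ennreal_power, simp, rule refl)
      moreover have "q ^ 3 * 8 ^ Suc j = ((1/2) ^ 3 * 8) ^ Suc j"
        unfolding q_def power_mult_distrib by (simp only: mult.commute flip: power_mult)
      then have "q ^ 3 * (8 ^ Suc j * real j) = real j"
        by (simp add: power3_eq_cube mult.assoc[symmetric] del: power_Suc)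
      ultimately show ?thesis
        by (simp add: ennreal_of_nat_eq_real_of_nat q_def flip: ennreal_mult del: power_Suc)
    qed
    moreover have "(1/2) ^ Suc j * emeasure (density lborel (h j)) X \<le> emeasure \<mu> X" if "X \<in> sets borel" for X
    proof -
      have "(1/2) ^ Suc j * emeasure (density lborel (h j)) X
          = (\<integral>\<^sup>+ y. (1/2) ^ Suc j * (h j y * indicator X y) \<partial>lborel)"
        using that by (simp add: emeasure_density nn_integral_cmult del: power_Suc)
      also have "\<dots> \<le> (\<integral>\<^sup>+ y. f y * indicator X y \<partial>lborel)"
      proof (rule nn_integral_mono)
        fix y
        have "(1/2) ^ Suc j * h j y \<le> f y"
          unfolding f_def using sum_le_suminf[of "\<lambda>j. (1/2) ^ Suc j * h j y" "{j}"] by simp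
        then show "(1/2) ^ Suc j * (h j y * indicator X y) \<le> f y * indicator X y"
          unfolding mult.assoc[symmetric] by (intro mult_right_mono) auto
      qed
      finally show ?thesis using that by (simp add: \<mu>_def emeasure_density)
    qed
    ultimately show "of_nat j \<le> ennreal (1 / e j ^ 3) * emeasure (\<mu> \<Otimes>\<^sub>M \<mu> \<Otimes>\<^sub>M \<mu>) (unit_triples B (e j))"
      using triples[OF sets sf, of "(1/2) ^ Suc j" j] by simp
  qed (use e in auto)
  then show ?thesis using sets sf energy by blast
qed

end

section \<open>The body and the conclusion\<close>

theorem theorem1p2:
  assumes "CARD('d::finite) > 3"
  shows "\<exists>B :: (real ^ 'd) set.
    symmetric_convex_body B \<and>
    smooth_hypersurface (frontier B) \<and>
    nonvanishing_gaussian_curvature (frontier B) \<and>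
    (\<forall>s::real. s < (real CARD('d) + 1) / 2 \<longrightarrow>
      (\<exists>\<mu> :: (real ^ 'd) measure.
        sets \<mu> = sets borel \<and> sigma_finite_measure \<mu> \<and>
        energy s \<mu> < \<infinity> \<and>
        Limsup (at_right 0) (\<lambda>\<epsilon>::real.
          ennreal (1 / \<epsilon> ^ 3) *
          emeasure (\<mu> \<Otimes>\<^sub>M \<mu> \<Otimes>\<^sub>M \<mu>)
            {(x1, x2, x3).
               1 - \<epsilon> \<le> body_norm B (x1 - x2) \<and> body_norm B (x1 - x2) \<le> 1 + \<epsilon> \<and>
               1 - \<epsilon> \<le> body_norm B (x1 - x3) \<and> body_norm B (x1 - x3) \<le> 1 + \<epsilon> \<and>
               1 - \<epsilon> \<le> body_norm B (x2 - x3) \<and> body_norm B (x2 - x3) \<le> 1 + \<epsilon>}) = \<infinity>))"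
proof -
  obtain \<phi> :: "nat \<Rightarrow> real \<Rightarrow> real" where \<phi>:
    "\<And>n x. (\<phi> n has_real_derivative \<phi> (Suc n) x) (at x)"
    "\<And>x. \<phi> 0 (- x) = \<phi> 0 x" "\<And>x. \<bar>x\<bar> \<ge> 1 \<Longrightarrow> \<phi> 0 x = \<bar>x\<bar>"
    "\<And>x. \<phi> 2 x \<ge> 0" "\<And>x. \<phi> 2 x > 0 \<or> \<phi> 1 x \<noteq> 0"
    using smooth_abs_exists by blast
  \<comment> \<open>An arbitrary coordinate serves as the vertical one.\<close>
  define k :: 'd where "k = undefined"
  define \<theta> :: "nat \<Rightarrow> real \<Rightarrow> real" where
    "\<theta> n = (case n of 0 \<Rightarrow> (\<lambda>x. x\<^sup>2) | Suc 0 \<Rightarrow> (\<lambda>x. 2 * x) | Suc (Suc 0) \<Rightarrow> (\<lambda>x. 2) | _ \<Rightarrow> (\<lambda>x. 0))" for n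
  define \<psi> where "\<psi> i = (if i = k then \<phi> else \<theta>)" for i
  have \<theta>: "(\<theta> n has_real_derivative \<theta> (Suc n) x) (at x)" for n x
    unfolding \<theta>_def by (auto intro!: derivative_eq_intros split: nat.split)
  have conv: "convex_on UNIV (\<phi> 0)"
    using \<phi>(1)[of 0] \<phi>(1)[of 1] \<phi>(4)
    by (intro f''_ge0_imp_convex[of _ _ "\<phi> 1" "\<phi> 2"]) (auto simp: numeral_2_eq_2)
  have \<phi>0: "\<phi> 0 0 \<le> 1"
    using convex_onD[OF conv, of "1 / 2" "-1" 1] \<phi>(3)[of 1] \<phi>(3)[of "-1"] by simp
  \<comment> \<open>The point 1 lies between \<open>y = \<bar>x\<bar>\<close> and 2. As
    \<open>\<phi> 0\<close> is the identity at 1 and 2, convexity forces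
    \<open>\<phi> 0 y \<ge> y\<close>.\<close>
  have \<phi>_nonneg: "0 \<le> \<phi> 0 x" if "\<bar>x\<bar> < 1" for x
  proof -
    define y where "y = \<bar>x\<bar>"
    define t where "t = (1 - y) / (2 - y)"
    have y: "0 \<le> y" "y < 1" using that by (auto simp: y_def)
    then have t: "0 \<le> t" "t < 1" "t * (2 - y) = 1 - y" by (auto simp: t_def)
    have "1 = (1 - t) * y + t * 2" using t(3) by (simp add: algebra_simps)
    then have "1 \<le> (1 - t) * \<phi> 0 y + t * 2"
      using convex_onD[OF conv, of t y 2] t \<phi>(3)[of 1] \<phi>(3)[of 2] by simp
    then have "0 \<le> (1 - t) * (\<phi> 0 y - y)" using t(3) by (simp add: algebra_simps)
    then have "0 \<le> \<phi> 0 y" using t y by (simp add: zero_le_mult_iff)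
    then show ?thesis using \<phi>(2)[of x] by (auto simp: y_def abs_if split: if_splits)
  qed
  interpret separable_body \<psi> k 8
  proof
    show "(\<psi> i n has_real_derivative \<psi> i (Suc n) x) (at x)" for i n x
      using \<theta> \<phi>(1) by (simp add: \<psi>_def)
    show "\<psi> i 0 (- x) = \<psi> i 0 x" for i x
      using \<phi>(2) by (simp add: \<psi>_def \<theta>_def)
    show "\<psi> i 0 x \<ge> \<bar>x\<bar> - 1" for i x
    proof (cases "i = k")
      case True
      then show ?thesis
        using \<phi>(3)[of x] \<phi>_nonneg[of x] by (cases "\<bar>x\<bar> < 1") (auto simp: \<psi>_def)
    next
      case False
      have "0 \<le> (\<bar>x\<bar> - 1)\<^sup>2" by simp
      then have "2 * \<bar>x\<bar> \<le> x\<^sup>2 + 1" by (simp add: power2_diff)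
      then show ?thesis using False zero_le_power2[of x] by (simp add: \<psi>_def \<theta>_def)
    qed
    show "\<psi> i 2 x \<ge> 0" for i x
      using \<phi>(4) by (simp add: \<psi>_def \<theta>_def numeral_2_eq_2)
    show "\<psi> i 2 x > 0" if "i \<noteq> k" for i x
      using that by (simp add: \<psi>_def \<theta>_def numeral_2_eq_2)
    show "\<psi> k 2 x > 0 \<or> \<psi> k 1 x \<noteq> 0" for x
      using \<phi>(5) by (simp add: \<psi>_def)
    have "(\<Sum>i\<in>UNIV. \<psi> i 0 0) = \<phi> 0 0"
      by (subst sum.remove[of _ k]) (auto simp: \<psi>_def \<theta>_def)
    then show "(\<Sum>i\<in>UNIV. \<psi> i 0 0) < 8" using \<phi>0 by simp
  qed
  have "paraboloid_body body k (CARD('d) - 1)"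
  proof
    show "symmetric_convex_body body" by (rule symmetric_convex_body_body)
    fix x :: "real ^ 'd" assume x: "x $ k \<ge> 1" "(\<Sum>i\<in>UNIV - {k}. (x $ i)\<^sup>2) + x $ k = 8"
    have "\<Psi> x = \<psi> k 0 (x $ k) + (\<Sum>i\<in>UNIV - {k}. \<psi> i 0 (x $ i))"
      unfolding \<Psi>_def by (rule sum.remove) auto
    also have "\<psi> k 0 (x $ k) = x $ k" using x(1) \<phi>(3)[of "x $ k"] by (simp add: \<psi>_def)
    also have "(\<Sum>i\<in>UNIV - {k}. \<psi> i 0 (x $ i)) = (\<Sum>i\<in>UNIV - {k}. (x $ i)\<^sup>2)"
      by (intro sum.cong) (auto simp: \<psi>_def \<theta>_def)
    finally show "body_norm body x = 1" using x(2) by (intro body_norm_eq_1) simp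
  qed (use assms in auto)
  then have "\<forall>s::real. s < (real CARD('d) + 1) / 2 \<longrightarrow>
      (\<exists>\<mu> :: (real ^ 'd) measure. sets \<mu> = sets borel \<and> sigma_finite_measure \<mu> \<and> energy s \<mu> < \<infinity> \<and>
        Limsup (at_right 0) (\<lambda>\<epsilon>::real.
          ennreal (1 / \<epsilon> ^ 3) * emeasure (\<mu> \<Otimes>\<^sub>M \<mu> \<Otimes>\<^sub>M \<mu>) (unit_triples body \<epsilon>)) = \<infinity>)"
    using paraboloid_body.exists_concentrated_measure by blast
  then show ?thesis
    using symmetric_convex_body_body smooth_hypersurface_body nonvanishing_gaussian_curvature_body
    unfolding unit_triples_def by blast
qed

end
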